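(* Let $m=n^{\alpha}$ with a constant $0<\alpha<1$, and let $p=p(n)$ satisfy $p=\Omega\!\left(\sqrt{1/(nm)}\right)$ and $mp^2=O(1)$. Then with high probability, the bipartite graph $B_{n,m,p}$ associated to a random instance $G_{n,m,p}$ of $\mathcal G_{n,m,p}$ is uniquely determined by $G_{n,m,p}$ (together with $n,m,p$), up to permutations of the labels.
   Context: Random intersection graph $\mathcal G_{n,m,p}$: a set $V$ of $n$ vertices and labels $\mathcal M=\{1,\dots,m\}$; each vertex $v$ independently receives $S_v\subseteq\mathcal M$ containing each label independently with probability $p$; distinct $u,v$ are adjacent iff $S_u\cap S_v\neq\emptyset$. For $i\in\mathcal M$, $L_i=\{v: i\in S_v\}$; the family $\{L_i: i\in\mathcal M\}$ is the label representation of the graph. The associated bipartite graph $B_{n,m,p}$ has vertex set $V\cup\mathcal M$ and edges $\{(v,i): i\in S_v\}$; it is determined by the label representation. "Uniquely determined" is meant in the maximum-likelihood sense: among the non-isomorphic (up to relabeling) associated bipartite graphs that could give rise to the observed graph, there is one $B^*$ with $\Pr(B^*\mid G_{n,m,p})>\Pr(B\mid G_{n,m,p})$ for every other such $B$. "With high probability" means with probability tending to $1$ as $n\to\infty$. *)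

theory Defs
  imports "HOL-Probability.Probability" "HOL-Probability.Product_PMF"
    "HOL-Library.Landau_Symbols" "HOL-Combinatorics.Permutations"
begin

text \<open>The vertex set is \<open>{..<n}\<close> and the label set is \<open>{1..m}\<close>. A random instance is described by
  the family \<open>S\<close> of label sets \<open>S v\<close>, which is fixed to be empty outside the vertex set.\<close>

definition random_label_set :: "nat \<Rightarrow> real \<Rightarrow> nat set pmf" where
  "random_label_set m p =
     map_pmf (\<lambda>f. {i. f i}) (Pi_pmf {1..m} False (\<lambda>_. bernoulli_pmf p))"

definition random_labelling :: "nat \<Rightarrow> nat \<Rightarrow> real \<Rightarrow> (nat \<Rightarrow> nat set) pmf" where
  "random_labelling n m p = Pi_pmf {..<n} {} (\<lambda>_. random_label_set m p)"

text \<open>Graphs on \<open>{..<n}\<close> and bipartite graphs with parts \<open>{..<n}\<close> and \<open>{1..m}\<close> are given by their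
  edge sets; in the bipartite case an edge is a pair (vertex, label), so the two parts may
  share natural numbers without being confused.\<close>

definition intersection_graph :: "nat \<Rightarrow> (nat \<Rightarrow> nat set) \<Rightarrow> nat set set" where
  "intersection_graph n S = {{u, v} | u v. u < n \<and> v < n \<and> u \<noteq> v \<and> S u \<inter> S v \<noteq> {}}"

definition assoc_bipartite :: "nat \<Rightarrow> (nat \<Rightarrow> nat set) \<Rightarrow> (nat \<times> nat) set" where
  "assoc_bipartite n S = {(v, i). v < n \<and> i \<in> S v}"

text \<open>The bipartite graphs that could give rise to \<open>G\<close>; \<open>B `` {v}\<close> is the label set of \<open>v\<close> in \<open>B\<close>.\<close>

definition bipartite_candidates :: "nat \<Rightarrow> nat \<Rightarrow> nat set set \<Rightarrow> (nat \<times> nat) set set" where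
  "bipartite_candidates n m G =
     {B. B \<subseteq> {..<n} \<times> {1..m} \<and> intersection_graph n (\<lambda>v. B `` {v}) = G}"

definition label_equivalent :: "nat \<Rightarrow> (nat \<times> nat) set \<Rightarrow> (nat \<times> nat) set \<Rightarrow> bool" where
  "label_equivalent m B B' \<longleftrightarrow> (\<exists>\<pi>. \<pi> permutes {1..m} \<and> B' = map_prod id \<pi> ` B)"

definition posterior :: "nat \<Rightarrow> nat \<Rightarrow> real \<Rightarrow> nat set set \<Rightarrow> (nat \<times> nat) set \<Rightarrow> real" where
  "posterior n m p G B =
     cond_prob (random_labelling n m p)
       (\<lambda>S. assoc_bipartite n S = B) (\<lambda>S. intersection_graph n S = G)"

text \<open>\<open>B\<close> is, up to a permutation of the labels, the unique maximum-likelihood bipartite graph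
  for \<open>G\<close>.\<close>

definition uniquely_determined ::
    "nat \<Rightarrow> nat \<Rightarrow> real \<Rightarrow> nat set set \<Rightarrow> (nat \<times> nat) set \<Rightarrow> bool" where
  "uniquely_determined n m p G B \<longleftrightarrow>
     B \<in> bipartite_candidates n m G \<and>
     (\<forall>B' \<in> bipartite_candidates n m G.
        \<not> label_equivalent m B B' \<longrightarrow> posterior n m p G B > posterior n m p G B')"

end

theory Submission
  imports Defs "HOL-Real_Asymp.Real_Asymp"
begin

text \<open>
  Write \<open>L\<^sub>i\<close> for the set of vertices carrying label \<open>i\<close>, and call a pair of vertices private to \<open>i\<close> if
  \<open>i\<close> is its only common label. Give a clique \<open>K\<close> the weight
  \<open>\<Sum>i. (fraction of the pairs private to i that lie inside K)\<close>. Every representation of the graph by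
  \<open>m\<close> cliques covers all edges, so the weights of its cliques add up to at least \<open>m\<close>. With high
  probability each clique has weight at most \<open>1\<close>, with equality only for the sets \<open>L\<^sub>i\<close>; hence the
  cliques of every representation are exactly the \<open>L\<^sub>i\<close>. So with high probability all candidates are
  label-equivalent, and likelihoods need not be compared.

  The bound on the weight is clear for small cliques and for subsets of some \<open>L\<^sub>i\<close>. For a large clique
  \<open>K\<close> and any \<open>r\<close> of its vertices, all but fewer than \<open>2 r\<close> of the others carry a label occurring at
  least twice among these \<open>r\<close> vertices, and there are at most \<open>r ^ 3\<close> such labels. Applying this twice
  gives a label \<open>i\<close> with \<open>card (K - L\<^sub>i) < r\<close>. If \<open>K\<close> contains a vertex outside \<open>L\<^sub>i\<close>, then it misses the
  non-neighbours of that vertex in \<open>L\<^sub>i\<close>, and with them a constant fraction of the pairs private to \<open>i\<close>.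
\<close>

subsection \<open>Clique covers of typical labellings\<close>

definition label_class :: "nat \<Rightarrow> (nat \<Rightarrow> nat set) \<Rightarrow> nat \<Rightarrow> nat set" where
  "label_class n S i = {v. v < n \<and> i \<in> S v}"

definition repeated_labels :: "('a \<Rightarrow> 'b set) \<Rightarrow> 'a set \<Rightarrow> 'b set" where
  "repeated_labels S D = {i. \<exists>v\<in>D. \<exists>w\<in>D. v \<noteq> w \<and> i \<in> S v \<and> i \<in> S w}"

definition scattered_neighbours :: "nat \<Rightarrow> (nat \<Rightarrow> nat set) \<Rightarrow> nat set \<Rightarrow> nat set" where
  "scattered_neighbours n S D =
     {u. u < n \<and> u \<notin> D \<and> (\<forall>v\<in>D. S u \<inter> (S v - repeated_labels S D) \<noteq> {})}"

text \<open>If \<open>i \<in> S v\<close>, these are the vertices joined to \<open>v\<close> by the label \<open>i\<close> alone; if \<open>i \<notin> S v\<close>, they are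
  the vertices with label \<open>i\<close> that are not adjacent to \<open>v\<close>.\<close>

definition private_neighbours :: "nat \<Rightarrow> (nat \<Rightarrow> nat set) \<Rightarrow> nat \<Rightarrow> nat \<Rightarrow> nat set" where
  "private_neighbours n S i v = {u. u < n \<and> u \<noteq> v \<and> i \<in> S u \<and> S u \<inter> S v \<subseteq> {i}}"

lemma finite_label_class [simp]: "finite (label_class n S i)"
  by (simp add: label_class_def)

lemma finite_private_neighbours [simp]: "finite (private_neighbours n S i v)"
  by (simp add: private_neighbours_def)

lemma finite_scattered_neighbours [simp]: "finite (scattered_neighbours n S D)"
  by (simp add: scattered_neighbours_def)

locale typical_labelling =
  fixes n m r :: nat and S :: "nat \<Rightarrow> nat set" and a b \<tau> :: real
  assumes labels: "\<And>v. v < n \<Longrightarrow> S v \<subseteq> {1..m}"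
    and common_labels: "\<And>v w. \<lbrakk>v < n; w < n; v \<noteq> w\<rbrakk> \<Longrightarrow> card (S v \<inter> S w) \<le> r"
    and common_vertices: "\<And>i j. \<lbrakk>i \<in> {1..m}; j \<in> {1..m}; i \<noteq> j\<rbrakk> \<Longrightarrow>
          real (card (label_class n S i \<inter> label_class n S j)) \<le> \<tau>"
    and few_scattered: "\<And>D. \<lbrakk>D \<subseteq> {..<n}; card D = r\<rbrakk> \<Longrightarrow> card (scattered_neighbours n S D) < 2 * r"
    and class_size: "\<And>i. i \<in> {1..m} \<Longrightarrow> real (card (label_class n S i)) \<le> b"
    and many_private: "\<And>i v. \<lbrakk>i \<in> {1..m}; v < n\<rbrakk> \<Longrightarrow> a \<le> real (card (private_neighbours n S i v))"
    and r_pos: "0 < r"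
    and a_large: "real r ^ 3 * (2 * r + real r ^ 3 * \<tau>) + 3 * r < a"
    and b_small: "2 * r * (b + r) * b\<^sup>2 < a ^ 4"
    and tau_nonneg: "0 \<le> \<tau>"
begin

definition priv :: "nat \<Rightarrow> (nat \<times> nat) set" where
  "priv i = {(u, v). u < n \<and> v < n \<and> u \<noteq> v \<and> S u \<inter> S v = {i}}"

definition clique :: "nat set \<Rightarrow> bool" where
  "clique K \<longleftrightarrow> K \<subseteq> {..<n} \<and> (\<forall>u\<in>K. \<forall>v\<in>K. u \<noteq> v \<longrightarrow> S u \<inter> S v \<noteq> {})"

definition weight :: "nat set \<Rightarrow> real" where
  "weight K = (\<Sum>i\<in>{1..m}. real (card (priv i \<inter> K \<times> K)) / real (card (priv i)))"

abbreviation "L \<equiv> label_class n S"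

lemma finite_clique: "clique K \<Longrightarrow> finite K"
  unfolding clique_def using finite_subset by blast

lemma a_pos: "0 < a"
proof -
  have "0 \<le> real r ^ 3 * (2 * r + real r ^ 3 * \<tau>) + 3 * r" using tau_nonneg by simp
  with a_large show ?thesis by linarith
qed

lemma r_less_a: "3 * real r < a"
proof -
  have "0 \<le> real r ^ 3 * (2 * r + real r ^ 3 * \<tau>)" using tau_nonneg by simp
  with a_large show ?thesis by linarith
qed

lemma priv_sub: "priv i \<subseteq> L i \<times> L i"
  unfolding priv_def label_class_def by auto

lemma finite_priv [simp]: "finite (priv i)"
  using priv_sub finite_label_class by (meson finite_SigmaI finite_subset)

lemma priv_disjoint: "i \<noteq> j \<Longrightarrow> priv i \<inter> priv j = {}"
  unfolding priv_def by auto

lemma class_size_ge: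
  assumes "i \<in> {1..m}" "0 < n"
  shows "a \<le> card (L i)"
proof -
  have "private_neighbours n S i 0 \<subseteq> L i" unfolding private_neighbours_def label_class_def by auto
  then have "card (private_neighbours n S i 0) \<le> card (L i)" by (intro card_mono) auto
  with many_private[OF assms(1), of 0] assms(2) show ?thesis by linarith
qed

lemma card_Sigma_private_ge:
  assumes i: "i \<in> {1..m}" and X: "X \<subseteq> L i"
  shows "card X * a \<le> card (priv i \<inter> X \<times> UNIV)"
proof -
  have fX: "finite X" using X finite_label_class by (rule finite_subset)
  have sub: "(SIGMA u:X. private_neighbours n S i u) \<subseteq> priv i \<inter> X \<times> UNIV"
    using X unfolding priv_def private_neighbours_def label_class_def by auto
  have "card X * a = (\<Sum>u\<in>X. a)" by simp
  also have "\<dots> \<le> (\<Sum>u\<in>X. real (card (private_neighbours n S i u)))"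
    using X by (intro sum_mono many_private i) (auto simp: label_class_def)
  also have "\<dots> = real (card (SIGMA u:X. private_neighbours n S i u))"
    using fX by (subst card_SigmaI) auto
  also have "\<dots> \<le> card (priv i \<inter> X \<times> UNIV)"
    using sub by (intro of_nat_mono card_mono) auto
  finally show ?thesis .
qed

lemma card_priv_ge:
  assumes i: "i \<in> {1..m}" and n: "0 < n"
  shows "a\<^sup>2 \<le> card (priv i)"
proof -
  have "a * a \<le> card (L i) * a" using class_size_ge[OF i n] a_pos by simp
  also have "\<dots> \<le> card (priv i \<inter> L i \<times> UNIV)" by (rule card_Sigma_private_ge[OF i order.refl])
  also have "\<dots> \<le> card (priv i)" by (intro of_nat_mono card_mono) auto
  finally show ?thesis by (simp add: power2_eq_square)
qed

lemma card_priv_le: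
  assumes "i \<in> {1..m}"
  shows "card (priv i) \<le> b\<^sup>2"
proof -
  have "card (priv i) \<le> card (L i \<times> L i)" using priv_sub by (intro card_mono) auto
  then have "real (card (priv i)) \<le> real (card (L i)) * real (card (L i))"
    by (simp add: card_cartesian_product flip: of_nat_mult)
  also have "\<dots> \<le> b * b" using class_size[OF assms] by (intro mult_mono) auto
  finally show ?thesis by (simp add: power2_eq_square)
qed

lemma card_repeated_labels:
  assumes D: "D \<subseteq> {..<n}" "card D = r"
  shows "card (repeated_labels S D) \<le> r ^ 3" and "repeated_labels S D \<subseteq> {1..m}"
proof -
  have fD: "finite D" using D(1) finite_subset by blast
  let ?P = "{(v, w). v \<in> D \<and> w \<in> D \<and> v \<noteq> w}"
  have Psub: "?P \<subseteq> D \<times> D" by auto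
  have fP: "finite ?P" using fD Psub by (meson finite_SigmaI finite_subset)
  have "repeated_labels S D = (\<Union>(v, w)\<in>?P. S v \<inter> S w)"
    unfolding repeated_labels_def by auto
  then have "card (repeated_labels S D) \<le> (\<Sum>x\<in>?P. card (case x of (v, w) \<Rightarrow> S v \<inter> S w))"
    using card_UN_le[OF fP] by simp
  also have "\<dots> \<le> (\<Sum>x\<in>?P. r)"
    using D(1) by (intro sum_mono) (auto intro!: common_labels)
  also have "\<dots> = card ?P * r" by simp
  also have "\<dots> \<le> card (D \<times> D) * r" using Psub fD by (intro mult_right_mono card_mono) auto
  also have "\<dots> = r ^ 3" using D by (simp add: card_cartesian_product power3_eq_cube)
  finally show "card (repeated_labels S D) \<le> r ^ 3" .
  show "repeated_labels S D \<subseteq> {1..m}"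
    using D labels unfolding repeated_labels_def by blast
qed

lemma clique_cover:
  assumes K: "clique K" and D: "D \<subseteq> K"
  shows "K - D \<subseteq> scattered_neighbours n S D \<union> (\<Union>i\<in>repeated_labels S D. L i)"
proof
  fix u assume u: "u \<in> K - D"
  then have un: "u < n" using K unfolding clique_def by auto
  show "u \<in> scattered_neighbours n S D \<union> (\<Union>i\<in>repeated_labels S D. L i)"
  proof (cases "S u \<inter> repeated_labels S D = {}")
    case True
    have "S u \<inter> (S v - repeated_labels S D) \<noteq> {}" if "v \<in> D" for v
    proof -
      have "u \<in> K" "v \<in> K" "u \<noteq> v" using u that D by auto
      then have "S u \<inter> S v \<noteq> {}" using K unfolding clique_def by simp
      with True show ?thesis by blast
    qed
    then show ?thesis using u un unfolding scattered_neighbours_def by auto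
  next
    case False
    then show ?thesis using un unfolding label_class_def by auto
  qed
qed

lemma large_clique_near_class:
  assumes K: "clique K" and size: "a \<le> card K"
  obtains i where "i \<in> {1..m}" "card (K - L i) < r"
proof -
  have fK: "finite K" and Kn: "K \<subseteq> {..<n}"
    using K finite_clique unfolding clique_def by auto
  have "r \<le> card K" using r_less_a size by linarith
  then obtain D where D: "D \<subseteq> K" "card D = r" "finite D"
    by (metis obtain_subset_with_card_n)
  let ?T = "repeated_labels S D"
  have Dn: "D \<subseteq> {..<n}" using D(1) Kn by blast
  have fT: "finite ?T" using card_repeated_labels(2)[OF Dn D(2)] finite_subset by blast
  have "\<exists>i\<in>?T. r ^ 3 * real (card (K \<inter> L i)) \<ge> a - 3 * r"
  proof (rule ccontr)
    assume "\<not> ?thesis"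
    then have small: "r ^ 3 * real (card (K \<inter> L i)) < a - 3 * r" if "i \<in> ?T" for i
      using that by force
    have "K \<subseteq> D \<union> scattered_neighbours n S D \<union> (\<Union>i\<in>?T. K \<inter> L i)"
      using clique_cover[OF K D(1)] by blast
    then have "card K \<le> card (D \<union> scattered_neighbours n S D \<union> (\<Union>i\<in>?T. K \<inter> L i))"
      using D(3) fT by (intro card_mono) auto
    also have "\<dots> \<le> card D + card (scattered_neighbours n S D) + card (\<Union>i\<in>?T. K \<inter> L i)"
      by (meson card_Un_le add_mono le_trans order.refl)
    also have "\<dots> \<le> card D + card (scattered_neighbours n S D) + (\<Sum>i\<in>?T. card (K \<inter> L i))"
      by (intro add_left_mono card_UN_le fT)
    also have "\<dots> < 3 * r + (\<Sum>i\<in>?T. card (K \<inter> L i))"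
      using few_scattered[OF Dn D(2)] D(2) by simp
    finally have "real (card K) < real (3 * r + (\<Sum>i\<in>?T. card (K \<inter> L i)))"
      by (rule of_nat_less_iff[THEN iffD2])
    then have "real r ^ 3 * (a - 3 * r) < real r ^ 3 * (\<Sum>i\<in>?T. real (card (K \<inter> L i)))"
      using size r_pos by (intro mult_strict_left_mono) auto
    also have "\<dots> = (\<Sum>i\<in>?T. r ^ 3 * real (card (K \<inter> L i)))" by (simp add: sum_distrib_left)
    also have "\<dots> \<le> (\<Sum>i\<in>?T. a - 3 * r)" using small by (intro sum_mono) (auto intro: less_imp_le)
    also have "\<dots> = real (card ?T) * (a - 3 * r)" by simp
    also have "\<dots> \<le> real (r ^ 3) * (a - 3 * r)"
      using r_less_a card_repeated_labels(1)[OF Dn D(2)] by (intro mult_right_mono of_nat_mono) auto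
    finally show False by simp
  qed
  then obtain i where i: "i \<in> ?T" "r ^ 3 * real (card (K \<inter> L i)) \<ge> a - 3 * r" by blast
  have im: "i \<in> {1..m}" using i(1) card_repeated_labels(2)[OF Dn D(2)] by blast
  have "card (K - L i) < r"
  proof (rule ccontr)
    assume "\<not> ?thesis"
    then obtain E where E: "E \<subseteq> K - L i" "card E = r" "finite E"
      by (metis obtain_subset_with_card_n not_less)
    let ?U = "repeated_labels S E"
    have En: "E \<subseteq> {..<n}" and EK: "E \<subseteq> K" using E(1) Kn by auto
    have fU: "finite ?U" using card_repeated_labels(2)[OF En E(2)] finite_subset by blast
    have iU: "i \<notin> ?U" using E(1) En unfolding repeated_labels_def label_class_def by blast
    have "K \<inter> L i \<subseteq> scattered_neighbours n S E \<union> (\<Union>j\<in>?U. L i \<inter> L j)"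
      using clique_cover[OF K EK] E(1) by blast
    then have "card (K \<inter> L i) \<le> card (scattered_neighbours n S E \<union> (\<Union>j\<in>?U. L i \<inter> L j))"
      using fU by (intro card_mono) auto
    also have "\<dots> \<le> card (scattered_neighbours n S E) + card (\<Union>j\<in>?U. L i \<inter> L j)"
      by (rule card_Un_le)
    also have "\<dots> \<le> 2 * r + (\<Sum>j\<in>?U. card (L i \<inter> L j))"
      by (intro add_mono card_UN_le fU less_imp_le few_scattered En E(2))
    finally have "real (card (K \<inter> L i)) \<le> real (2 * r + (\<Sum>j\<in>?U. card (L i \<inter> L j)))"
      by (rule of_nat_mono)
    also have "\<dots> = 2 * r + (\<Sum>j\<in>?U. real (card (L i \<inter> L j)))" by simp
    also have "\<dots> \<le> 2 * r + (\<Sum>j\<in>?U. \<tau>)"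
      using iU im card_repeated_labels(2)[OF En E(2)]
      by (intro add_left_mono sum_mono common_vertices) auto
    also have "\<dots> = 2 * r + real (card ?U) * \<tau>" by simp
    also have "\<dots> \<le> 2 * r + real (r ^ 3) * \<tau>"
      using tau_nonneg card_repeated_labels(1)[OF En E(2)]
      by (intro add_left_mono mult_right_mono of_nat_mono) auto
    finally have "real r ^ 3 * real (card (K \<inter> L i)) \<le> real r ^ 3 * (2 * r + real r ^ 3 * \<tau>)"
      by (intro mult_left_mono) auto
    with i(2) a_large show False by simp
  qed
  with im that show thesis by blast
qed

lemma sum_priv_le:
  assumes J: "J \<subseteq> {1..m}" and n: "0 < n" and F: "finite F"
    and sub: "\<And>i. i \<in> J \<Longrightarrow> priv i \<inter> K \<times> K \<subseteq> F"
  shows "(\<Sum>i\<in>J. real (card (priv i \<inter> K \<times> K)) / real (card (priv i))) \<le> card F / a\<^sup>2"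
proof -
  have fJ: "finite J" using J finite_subset by blast
  have "(\<Sum>i\<in>J. real (card (priv i \<inter> K \<times> K)) / real (card (priv i)))
      \<le> (\<Sum>i\<in>J. real (card (priv i \<inter> K \<times> K)) / a\<^sup>2)"
  proof (rule sum_mono)
    fix i assume "i \<in> J"
    with J have "a\<^sup>2 \<le> card (priv i)" using card_priv_ge n by blast
    moreover have "0 < a\<^sup>2" using a_pos by simp
    ultimately show "real (card (priv i \<inter> K \<times> K)) / real (card (priv i))
        \<le> real (card (priv i \<inter> K \<times> K)) / a\<^sup>2"
      by (intro divide_left_mono mult_pos_pos) linarith+
  qed
  also have "\<dots> = real (\<Sum>i\<in>J. card (priv i \<inter> K \<times> K)) / a\<^sup>2"
    by (simp add: sum_divide_distrib)
  also have "(\<Sum>i\<in>J. card (priv i \<inter> K \<times> K)) = card (\<Union>i\<in>J. priv i \<inter> K \<times> K)"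
    using fJ priv_disjoint by (subst card_UN_disjoint) auto
  also have "card (\<Union>i\<in>J. priv i \<inter> K \<times> K) \<le> card F"
    using sub F by (intro card_mono) auto
  finally show ?thesis by (simp add: divide_right_mono)
qed

lemma weight_subset_class:
  assumes i: "i \<in> {1..m}" and K: "K \<subseteq> L i"
  shows "weight K \<le> 1" and "K \<noteq> L i \<Longrightarrow> weight K < 1"
proof -
  have other: "priv j \<inter> K \<times> K = {}" if "j \<noteq> i" for j
    using K that unfolding priv_def label_class_def by fast
  have "weight K = (\<Sum>j\<in>{i}. real (card (priv j \<inter> K \<times> K)) / real (card (priv j)))"
    unfolding weight_def using i other by (intro sum.mono_neutral_right) auto
  then have w: "weight K = real (card (priv i \<inter> K \<times> K)) / real (card (priv i))" by simp
  have le: "card (priv i \<inter> K \<times> K) \<le> card (priv i)" by (intro card_mono) auto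
  show "weight K \<le> 1" unfolding w using le by (intro divide_le_eq_1[THEN iffD2]) linarith
  assume "K \<noteq> L i"
  then obtain v where v: "v \<in> L i" "v \<notin> K" using K by blast
  then have vn: "v < n" by (auto simp: label_class_def)
  have "private_neighbours n S i v \<noteq> {}" using many_private[OF i vn] a_pos by auto
  then obtain u where "u \<in> private_neighbours n S i v" by blast
  then have uv: "(u, v) \<in> priv i"
    using v unfolding private_neighbours_def priv_def label_class_def by auto
  then have "priv i \<inter> K \<times> K \<subset> priv i" using v by auto
  then have "card (priv i \<inter> K \<times> K) < card (priv i)" by (intro psubset_card_mono) auto
  then show "weight K < 1" unfolding w by simp
qed

lemma weight_near_class:
  assumes K: "clique K" and i: "i \<in> {1..m}" and near: "card (K - L i) < r" and nsub: "\<not> K \<subseteq> L i"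
  shows "weight K < 1"
proof -
  have fK: "finite K" using K finite_clique by blast
  obtain v where v: "v \<in> K" "v \<notin> L i" using nsub by blast
  then have vn: "v < n" and iv: "i \<notin> S v" using K unfolding clique_def label_class_def by auto
  then have n: "0 < n" by simp
  let ?X = "private_neighbours n S i v"
  have XL: "?X \<subseteq> L i" unfolding private_neighbours_def label_class_def by auto
  have XK: "?X \<inter> K = {}"
    using K v iv unfolding private_neighbours_def clique_def by blast
  have "a\<^sup>2 \<le> card ?X * a" using many_private[OF i vn] a_pos by (simp add: power2_eq_square)
  also have "\<dots> \<le> card (priv i \<inter> ?X \<times> UNIV)" by (rule card_Sigma_private_ge[OF i XL])
  finally have lost: "a\<^sup>2 \<le> card (priv i \<inter> ?X \<times> UNIV)" .
  have "card (priv i \<inter> K \<times> K) + card (priv i \<inter> ?X \<times> UNIV) =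
        card ((priv i \<inter> K \<times> K) \<union> (priv i \<inter> ?X \<times> UNIV))"
    using XK by (intro card_Un_disjoint[symmetric]) auto
  also have "\<dots> \<le> card (priv i)" by (intro card_mono) auto
  finally have main: "real (card (priv i \<inter> K \<times> K)) \<le> card (priv i) - a\<^sup>2" using lost by linarith
  have pp: "0 < real (card (priv i))" 
    by (rule less_le_trans[OF _ card_priv_ge[OF i n]]) (use a_pos in simp)
  have b: "0 < b" using class_size_ge[OF i n] class_size[OF i] a_pos by linarith
  have term_i: "real (card (priv i \<inter> K \<times> K)) / real (card (priv i)) \<le> 1 - a\<^sup>2 / b\<^sup>2"
  proof -
    have "real (card (priv i \<inter> K \<times> K)) / real (card (priv i)) \<le> (card (priv i) - a\<^sup>2) / card (priv i)"
      using main pp by (intro divide_right_mono) auto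
    also have "\<dots> = 1 - a\<^sup>2 / card (priv i)" using pp by (simp only: diff_divide_distrib divide_self)
    also have "\<dots> \<le> 1 - a\<^sup>2 / b\<^sup>2"
      using pp card_priv_le[OF i] b by (intro diff_left_mono divide_left_mono) auto
    finally show ?thesis .
  qed
  let ?F = "(K - L i) \<times> K \<union> K \<times> (K - L i)"
  have "(\<Sum>j\<in>{1..m} - {i}. real (card (priv j \<inter> K \<times> K)) / real (card (priv j))) \<le> card ?F / a\<^sup>2"
  proof (rule sum_priv_le[OF _ n])
    fix j assume "j \<in> {1..m} - {i}"
    then show "priv j \<inter> K \<times> K \<subseteq> ?F" unfolding priv_def label_class_def by fast
  qed (use fK in auto)
  moreover have "real (card ?F) \<le> 2 * r * (b + r)"
  proof -
    have "card ?F \<le> card (K - L i) * card K + card K * card (K - L i)"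
      using card_Un_le[of "(K - L i) \<times> K" "K \<times> (K - L i)"] by (simp add: card_cartesian_product)
    also have "\<dots> \<le> r * card K + card K * r" using near by (intro add_mono mult_mono) auto
    finally have "card ?F \<le> 2 * r * card K" by (simp add: algebra_simps)
    then have "real (card ?F) \<le> real (2 * r * card K)" by (rule of_nat_mono)
    then have "real (card ?F) \<le> 2 * r * real (card K)" by simp
    also
    have "card K \<le> card (L i) + card (K - L i)"
      using card_Un_le[of "L i" "K - L i"] card_mono[of "L i \<union> (K - L i)" K] fK by force
    then have "real (card K) \<le> b + r" using class_size[OF i] near by linarith
    then have "2 * r * real (card K) \<le> 2 * r * (b + r)" by (intro mult_left_mono) auto
    finally show ?thesis .
  qed
  ultimately have rest: "(\<Sum>j\<in>{1..m} - {i}. real (card (priv j \<inter> K \<times> K)) / real (card (priv j)))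
      \<le> 2 * r * (b + r) / a\<^sup>2"
    using a_pos by (meson divide_right_mono order_trans zero_le_power2)
  have "2 * r * (b + r) / a\<^sup>2 < a\<^sup>2 / b\<^sup>2"
  proof -
    have "a ^ 4 = a\<^sup>2 * a\<^sup>2" by (simp flip: power_add)
    with b_small have "2 * r * (b + r) * b\<^sup>2 < a\<^sup>2 * a\<^sup>2" by (simp only:)
    then have "2 * r * (b + r) < a\<^sup>2 * a\<^sup>2 / b\<^sup>2"
      using b by (intro pos_less_divide_eq[THEN iffD2]) (simp, simp only:)
    then have "2 * r * (b + r) < a\<^sup>2 / b\<^sup>2 * a\<^sup>2" by (simp only: times_divide_eq_left)
    then show ?thesis using a_pos by (intro pos_divide_less_eq[THEN iffD2]) (simp, simp only:)
  qed
  moreover have "weight K = real (card (priv i \<inter> K \<times> K)) / real (card (priv i)) +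
      (\<Sum>j\<in>{1..m} - {i}. real (card (priv j \<inter> K \<times> K)) / real (card (priv j)))"
    unfolding weight_def using i by (intro sum.remove) auto
  ultimately show ?thesis using term_i rest by linarith
qed

lemma weight_le_1:
  assumes K: "clique K"
  shows "weight K \<le> 1 \<and> (weight K = 1 \<longrightarrow> (\<exists>i\<in>{1..m}. K = L i))"
proof (cases "\<exists>i\<in>{1..m}. K \<subseteq> L i")
  case True
  then obtain i where "i \<in> {1..m}" "K \<subseteq> L i" by blast
  with weight_subset_class[of i K] show ?thesis by (cases "K = L i") auto
next
  case False
  have "weight K < 1"
  proof (cases "a \<le> card K")
    case True
    with K obtain i where "i \<in> {1..m}" "card (K - L i) < r" by (rule large_clique_near_class)
    with False K show ?thesis using weight_near_class by blast
  next
    case small: False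
    show ?thesis
    proof (cases "n = 0")
      case True
      then have "priv i = {}" for i unfolding priv_def by simp
      then show ?thesis by (simp add: weight_def)
    next
      case n: False
      have "weight K \<le> card (K \<times> K) / a\<^sup>2"
        unfolding weight_def using n finite_clique[OF K] by (intro sum_priv_le) auto
      also have "\<dots> = (card K)\<^sup>2 / a\<^sup>2" by (simp add: card_cartesian_product power2_eq_square)
      also have "\<dots> < 1" using small a_pos by (simp add: power_strict_mono)
      finally show ?thesis .
    qed
  qed
  then show ?thesis by simp
qed

lemma priv_nonempty:
  assumes "i \<in> {1..m}" "0 < n"
  shows "priv i \<noteq> {}"
proof
  assume "priv i = {}"
  with card_priv_ge[OF assms] a_pos show False by simp
qed

lemma candidate_classes:
  assumes B: "B \<in> bipartite_candidates n m (intersection_graph n S)"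
  shows "clique {v. (v, j) \<in> B}"
    and "i \<in> {1..m} \<Longrightarrow> priv i \<subseteq> (\<Union>j\<in>{1..m}. {v. (v, j) \<in> B} \<times> {v. (v, j) \<in> B})"
proof -
  have Bsub: "B \<subseteq> {..<n} \<times> {1..m}"
    and G: "intersection_graph n (\<lambda>v. B `` {v}) = intersection_graph n S"
    using B unfolding bipartite_candidates_def by auto
  have adj: "B `` {u} \<inter> B `` {v} \<noteq> {} \<longleftrightarrow> S u \<inter> S v \<noteq> {}" if "u < n" "v < n" "u \<noteq> v" for u v
  proof -
    have edge: "{u, v} \<in> intersection_graph n F \<longleftrightarrow> F u \<inter> F v \<noteq> {}" for F
      unfolding intersection_graph_def using that
      by (auto simp: doubleton_eq_iff)
    show ?thesis using G edge[of S] edge[of "\<lambda>v. B `` {v}"] by simp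
  qed
  show "clique {v. (v, j) \<in> B}"
    unfolding clique_def
  proof (intro conjI ballI impI)
    show "{v. (v, j) \<in> B} \<subseteq> {..<n}" using Bsub by auto
    fix u v assume uv: "u \<in> {v. (v, j) \<in> B}" "v \<in> {v. (v, j) \<in> B}" "u \<noteq> v"
    then have "u < n" "v < n" "B `` {u} \<inter> B `` {v} \<noteq> {}" using Bsub by auto
    with adj uv(3) show "S u \<inter> S v \<noteq> {}" by blast
  qed
  show "priv i \<subseteq> (\<Union>j\<in>{1..m}. {v. (v, j) \<in> B} \<times> {v. (v, j) \<in> B})"
  proof clarify
    fix u v assume uv: "(u, v) \<in> priv i"
    then have "B `` {u} \<inter> B `` {v} \<noteq> {}" using adj[of u v] by (auto simp: priv_def)
    then obtain j where "(u, j) \<in> B" "(v, j) \<in> B" by blast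
    with Bsub show "(u, v) \<in> (\<Union>j\<in>{1..m}. {v. (v, j) \<in> B} \<times> {v. (v, j) \<in> B})" by auto
  qed
qed

lemma sum_weight_ge:
  assumes n: "0 < n" and cover: "\<And>i. i \<in> {1..m} \<Longrightarrow> priv i \<subseteq> (\<Union>j\<in>{1..m}. C j \<times> C j)"
  shows "m \<le> (\<Sum>j\<in>{1..m}. weight (C j))"
proof -
  have "real m = (\<Sum>i\<in>{1..m}. 1)" by simp
  also have "\<dots> \<le> (\<Sum>i\<in>{1..m}. (\<Sum>j\<in>{1..m}. real (card (priv i \<inter> C j \<times> C j)) / card (priv i)))"
  proof (rule sum_mono)
    fix i assume i: "i \<in> {1..m}"
    have pos: "0 < card (priv i)" using priv_nonempty[OF i n] by (simp add: card_gt_0_iff)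
    have "priv i = (\<Union>j\<in>{1..m}. priv i \<inter> C j \<times> C j)" using cover[OF i] by blast
    then have "card (priv i) \<le> (\<Sum>j\<in>{1..m}. card (priv i \<inter> C j \<times> C j))"
      using card_UN_le[of "{1..m}" "\<lambda>j. priv i \<inter> C j \<times> C j"] by simp
    then have "real (card (priv i)) \<le> (\<Sum>j\<in>{1..m}. real (card (priv i \<inter> C j \<times> C j)))"
      by (simp flip: of_nat_sum)
    then show "1 \<le> (\<Sum>j\<in>{1..m}. real (card (priv i \<inter> C j \<times> C j)) / card (priv i))"
      using pos by (simp flip: sum_divide_distrib)
  qed
  also have "\<dots> = (\<Sum>j\<in>{1..m}. weight (C j))" unfolding weight_def by (rule sum.swap)
  finally show ?thesis .
qed

theorem candidate_label_equivalent:
  assumes B: "B \<in> bipartite_candidates n m (intersection_graph n S)"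
  shows "label_equivalent m (assoc_bipartite n S) B"
proof (cases "n = 0")
  case True
  then have "B = {}" "assoc_bipartite n S = {}"
    using B by (auto simp: bipartite_candidates_def assoc_bipartite_def)
  then show ?thesis unfolding label_equivalent_def by (intro exI[of _ id]) (simp add: permutes_id)
next
  case False
  then have n: "0 < n" by simp
  let ?C = "\<lambda>j. {v. (v, j) \<in> B}"
  have cl: "clique (?C j)" for j by (rule candidate_classes[OF B])
  have ge: "m \<le> (\<Sum>j\<in>{1..m}. weight (?C j))"
    by (rule sum_weight_ge[OF n]) (rule candidate_classes[OF B])
  have w1: "weight (?C j) = 1" if j: "j \<in> {1..m}" for j
  proof (rule ccontr)
    assume "weight (?C j) \<noteq> 1"
    then have "weight (?C j) < 1" using weight_le_1[OF cl, of j] by simp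
    then have "(\<Sum>j\<in>{1..m}. weight (?C j)) < (\<Sum>j\<in>{1..m}. 1)"
      using weight_le_1[OF cl] j by (intro sum_strict_mono_ex1) auto
    with ge show False by simp
  qed
  then have "\<forall>j\<in>{1..m}. \<exists>i\<in>{1..m}. ?C j = L i" using weight_le_1[OF cl] by blast
  then obtain f where f: "\<And>j. j \<in> {1..m} \<Longrightarrow> f j \<in> {1..m}" "\<And>j. j \<in> {1..m} \<Longrightarrow> ?C j = L (f j)"
    by metis
  have "{1..m} \<subseteq> f ` {1..m}"
  proof
    fix i assume i: "i \<in> {1..m}"
    obtain u v where uv: "(u, v) \<in> priv i" using priv_nonempty[OF i n] by auto
    then obtain j where j: "j \<in> {1..m}" "u \<in> ?C j" "v \<in> ?C j"
      using candidate_classes(2)[OF B i] by blast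
    then have "u \<in> L (f j)" "v \<in> L (f j)" using f(2) by auto
    with uv have "f j = i" unfolding priv_def label_class_def by auto
    with j(1) show "i \<in> f ` {1..m}" by blast
  qed
  with f(1) have img: "f ` {1..m} = {1..m}" by blast
  then have inj: "inj_on f {1..m}" by (simp add: eq_card_imp_inj_on)
  define g where "g i = (if i \<in> {1..m} then inv_into {1..m} f i else i)" for i
  have bij: "bij_betw (inv_into {1..m} f) {1..m} {1..m}"
    using img inj by (intro bij_betw_inv_into) (simp add: bij_betw_def)
  have "bij_betw g {1..m} {1..m}"
    using bij by (rule bij_betw_cong[THEN iffD1, rotated]) (simp add: g_def)
  then have perm: "g permutes {1..m}" by (rule bij_imp_permutes) (auto simp: g_def)
  have gf: "g (f j) = j" if "j \<in> {1..m}" for j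
    using that f(1) inj by (simp add: g_def)
  have gm: "g i \<in> {1..m}" if "i \<in> {1..m}" for i
    using that permutes_in_image[OF perm] by blast
  have fg: "f (g i) = i" if "i \<in> {1..m}" for i
    using that img by (simp add: g_def f_inv_into_f)
  have Bsub: "B \<subseteq> {..<n} \<times> {1..m}" using B unfolding bipartite_candidates_def by auto
  have "B = map_prod id g ` assoc_bipartite n S"
  proof (intro set_eqI iffI)
    fix x assume x: "x \<in> B"
    obtain v j where vj: "x = (v, j)" by force
    then have j: "j \<in> {1..m}" using x Bsub by auto
    have "v \<in> L (f j)" using x vj f(2)[OF j] by blast
    then have "(v, f j) \<in> assoc_bipartite n S" by (auto simp: label_class_def assoc_bipartite_def)
    then have "map_prod id g (v, f j) \<in> map_prod id g ` assoc_bipartite n S" by (rule imageI)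
    then show "x \<in> map_prod id g ` assoc_bipartite n S" using vj gf[OF j] by simp
  next
    fix x assume "x \<in> map_prod id g ` assoc_bipartite n S"
    then obtain v i where vi: "v < n" "i \<in> S v" "x = (v, g i)" by (auto simp: assoc_bipartite_def)
    then have i: "i \<in> {1..m}" using labels by blast
    then have "v \<in> L (f (g i))" using vi fg by (simp add: label_class_def)
    then have "v \<in> ?C (g i)" using f(2) gm[OF i] by blast
    then show "x \<in> B" using vi by simp
  qed
  with perm show ?thesis unfolding label_equivalent_def by blast
qed

lemma uniquely_determined_assoc_bipartite:
  "uniquely_determined n m p (intersection_graph n S) (assoc_bipartite n S)"
proof -
  have "assoc_bipartite n S `` {v} = S v" if "v < n" for v
    using that by (auto simp: assoc_bipartite_def)
  then have "intersection_graph n (\<lambda>v. assoc_bipartite n S `` {v}) = intersection_graph n S"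
    unfolding intersection_graph_def by (simp cong: conj_cong)
  moreover have "assoc_bipartite n S \<subseteq> {..<n} \<times> {1..m}"
    unfolding assoc_bipartite_def using labels by blast
  ultimately have "assoc_bipartite n S \<in> bipartite_candidates n m (intersection_graph n S)"
    by (simp add: bipartite_candidates_def)
  then show ?thesis
    unfolding uniquely_determined_def using candidate_label_equivalent by blast
qed

end

subsection \<open>Tail bounds for products of distributions\<close>

lemma prob_Pi_pmf_Ball_le:
  assumes A: "finite A" and U: "U \<subseteq> A"
    and t: "\<And>x. x \<in> U \<Longrightarrow> measure_pmf.prob (q x) (E x) \<le> t"
  shows "measure_pmf.prob (Pi_pmf A d q) {f. \<forall>x\<in>U. f x \<in> E x} \<le> t ^ card U"
proof -
  have eq: "{f. \<forall>x\<in>U. f x \<in> E x} = Pi A (\<lambda>x. if x \<in> U then E x else UNIV)"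
    using U by (auto simp: Pi_def)
  have "measure_pmf.prob (Pi_pmf A d q) {f. \<forall>x\<in>U. f x \<in> E x} =
        (\<Prod>x\<in>A. measure_pmf.prob (q x) (if x \<in> U then E x else UNIV))"
    unfolding eq by (rule measure_Pi_pmf_Pi[OF A])
  also have "\<dots> = (\<Prod>x\<in>U. measure_pmf.prob (q x) (E x))"
    using A U by (intro prod.mono_neutral_cong_right) auto
  also have "\<dots> \<le> (\<Prod>x\<in>U. t)" using t by (intro prod_mono) auto
  finally show ?thesis by simp
qed

lemma prob_UN_le:
  fixes t :: real
  assumes "finite I" and "\<And>i. i \<in> I \<Longrightarrow> measure_pmf.prob M (X i) \<le> t" and "Y \<subseteq> (\<Union>i\<in>I. X i)"
  shows "measure_pmf.prob M Y \<le> card I * t"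
proof -
  have "measure_pmf.prob M Y \<le> measure_pmf.prob M (\<Union>i\<in>I. X i)"
    using assms(3) by (intro measure_pmf.finite_measure_mono) auto
  also have "\<dots> \<le> (\<Sum>i\<in>I. measure_pmf.prob M (X i))"
    using assms(1) by (intro measure_pmf.finite_measure_subadditive_finite) auto
  also have "\<dots> \<le> (\<Sum>i\<in>I. t)" using assms(2) by (rule sum_mono)
  finally show ?thesis by simp
qed

lemma prob_Pi_pmf_count_ge:
  fixes t :: real
  assumes A: "finite A" and t: "\<And>x. x \<in> A \<Longrightarrow> measure_pmf.prob (q x) (E x) \<le> t"
  shows "measure_pmf.prob (Pi_pmf A d q) {f. k \<le> card {x\<in>A. f x \<in> E x}} \<le> (card A choose k) * t ^ k"
proof -
  let ?I = "{U. U \<subseteq> A \<and> card U = k}"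
  have "measure_pmf.prob (Pi_pmf A d q) {f. k \<le> card {x\<in>A. f x \<in> E x}} \<le> card ?I * t ^ k"
  proof (rule prob_UN_le)
    show "finite ?I" using A by simp
    fix U assume "U \<in> ?I"
    then show "measure_pmf.prob (Pi_pmf A d q) {f. \<forall>x\<in>U. f x \<in> E x} \<le> t ^ k"
      using prob_Pi_pmf_Ball_le[OF A, of U q E t d] t by auto
  next
    show "{f. k \<le> card {x\<in>A. f x \<in> E x}} \<subseteq> (\<Union>U\<in>?I. {f. \<forall>x\<in>U. f x \<in> E x})"
    proof
      fix f assume "f \<in> {f. k \<le> card {x\<in>A. f x \<in> E x}}"
      then have "k \<le> card {x\<in>A. f x \<in> E x}" by simp
      then obtain U where "U \<subseteq> {x\<in>A. f x \<in> E x}" "card U = k"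
        by (rule obtain_subset_with_card_n)
      then show "f \<in> (\<Union>U\<in>?I. {f. \<forall>x\<in>U. f x \<in> E x})" by auto
    qed
  qed
  then show ?thesis using A by (simp add: n_subsets)
qed

text \<open>Markov's inequality for \<open>(1 / 2) ^ X\<close>, where \<open>X\<close> is the number of successes.\<close>

lemma prob_Pi_pmf_count_le:
  assumes A: "finite A" and t: "\<And>x. x \<in> A \<Longrightarrow> t \<le> measure_pmf.prob (q x) (E x)" and t0: "0 \<le> t"
  shows "measure_pmf.prob (Pi_pmf A d q) {f. real (card {x\<in>A. f x \<in> E x}) \<le> t * card A / 4}
          \<le> exp (- (t * card A / 4))"
proof -
  let ?M = "Pi_pmf A d q" and ?k = "t * card A / 4"
  let ?u = "\<lambda>x y. if y \<in> E x then 1/2 else (1::real)"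
  have int: "integrable (measure_pmf M) (?u x)" for x and M :: "'b pmf"
    by (rule measure_pmf.integrable_const_bound[where B = 1]) auto
  have prod_eq: "(\<Prod>x\<in>A. ?u x (f x)) = (1/2) ^ card {x\<in>A. f x \<in> E x}" for f
  proof -
    have "(\<Prod>x\<in>A. ?u x (f x)) = (\<Prod>x\<in>{x\<in>A. f x \<in> E x}. 1/2)"
      using A by (intro prod.mono_neutral_cong_right) auto
    then show ?thesis by simp
  qed
  have "measure_pmf.prob ?M {f. real (card {x\<in>A. f x \<in> E x}) \<le> ?k}
      \<le> measure_pmf.prob ?M {f\<in>space ?M. exp (- ?k) \<le> (\<Prod>x\<in>A. ?u x (f x))}"
  proof (intro measure_pmf.finite_measure_mono subsetI)
    fix f assume "f \<in> {f. real (card {x\<in>A. f x \<in> E x}) \<le> ?k}"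
    then have le: "real (card {x\<in>A. f x \<in> E x}) \<le> ?k" by simp
    have half: "exp (- 1) \<le> (1/2 :: real)"
      using exp_ge_add_one_self[of 1] by (simp add: exp_minus field_simps)
    have "exp (- ?k) \<le> exp (- real (card {x\<in>A. f x \<in> E x}))" using le by simp
    also have "\<dots> = exp (- 1) ^ card {x\<in>A. f x \<in> E x}" by (simp flip: exp_of_nat_mult)
    also have "\<dots> \<le> (1/2) ^ card {x\<in>A. f x \<in> E x}" using half by (intro power_mono) auto
    finally show "f \<in> {f\<in>space ?M. exp (- ?k) \<le> (\<Prod>x\<in>A. ?u x (f x))}"
      by (simp add: prod_eq)
  qed simp
  also have "\<dots> \<le> measure_pmf.expectation ?M (\<lambda>f. \<Prod>x\<in>A. ?u x (f x)) / exp (- ?k)"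
    by (rule integral_Markov_inequality_measure[where A = "UNIV"])
       (auto intro!: integrable_prod_Pi_pmf A int prod_nonneg)
  also have "measure_pmf.expectation ?M (\<lambda>f. \<Prod>x\<in>A. ?u x (f x)) =
      (\<Prod>x\<in>A. measure_pmf.expectation (q x) (?u x))"
    by (rule expectation_prod_Pi_pmf) (auto intro: A int)
  also have "(\<Prod>x\<in>A. measure_pmf.expectation (q x) (?u x)) \<le> (\<Prod>x\<in>A. exp (- (t / 2)))"
  proof (rule prod_mono)
    fix x assume x: "x \<in> A"
    have ind: "integrable (measure_pmf (q x)) (indicat_real (E x))"
      by (rule measure_pmf.integrable_const_bound[where B = 1]) auto
    have "?u x = (\<lambda>y. 1 - 1/2 * indicator (E x) y)" by (auto simp: indicator_def)
    then have "measure_pmf.expectation (q x) (?u x) = 1 - measure_pmf.prob (q x) (E x) / 2"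
      by (simp add: Bochner_Integration.integral_diff ind)
    also have "\<dots> \<le> 1 + (- (t / 2))" using t[OF x] by simp
    also have "\<dots> \<le> exp (- (t / 2))" by (rule exp_ge_add_one_self)
    finally show "0 \<le> measure_pmf.expectation (q x) (?u x) \<and>
        measure_pmf.expectation (q x) (?u x) \<le> exp (- (t / 2))"
      by (auto intro!: integral_nonneg_AE)
  qed
  also have "(\<Prod>x\<in>A. exp (- (t / 2))) = exp (- (t * card A / 2))"
    by (simp add: algebra_simps flip: exp_of_nat_mult)
  also have "exp (- (t * card A / 2)) / exp (- ?k) = exp (- ?k)"
    by (simp flip: exp_diff)
  finally show ?thesis by (simp add: divide_right_mono)
qed

lemma prob_Pi_pmf_union_le:
  assumes "finite A" "finite B" "A \<inter> B = {}" and e: "0 \<le> e"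
    and Y: "\<And>f. f \<in> set_pmf (Pi_pmf A d q) \<Longrightarrow> f \<in> Y \<Longrightarrow>
              measure_pmf.prob (Pi_pmf B d q) {g. (\<lambda>x. if x \<in> A then f x else g x) \<in> X} \<le> e"
    and nY: "\<And>f g. f \<in> set_pmf (Pi_pmf A d q) \<Longrightarrow> (\<lambda>x. if x \<in> A then f x else g x) \<in> X \<Longrightarrow> f \<in> Y"
  shows "measure_pmf.prob (Pi_pmf (A \<union> B) d q) X \<le> measure_pmf.prob (Pi_pmf A d q) Y * e"
proof -
  let ?h = "\<lambda>f g x. if x \<in> A then f x else g x"
  have "Pi_pmf (A \<union> B) d q = bind_pmf (Pi_pmf A d q) (\<lambda>f. map_pmf (?h f) (Pi_pmf B d q))"
    unfolding Pi_pmf_union[OF assms(1-3)] pair_pmf_def map_pmf_def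
    by (simp add: bind_assoc_pmf bind_return_pmf)
  then have "emeasure (Pi_pmf (A \<union> B) d q) X =
      (\<integral>\<^sup>+f. emeasure (map_pmf (?h f) (Pi_pmf B d q)) X \<partial>Pi_pmf A d q)"
    by (simp only: emeasure_bind_pmf)
  also have "\<dots> \<le> (\<integral>\<^sup>+f. ennreal e * indicator Y f \<partial>Pi_pmf A d q)"
  proof (rule nn_integral_mono_AE, rule AE_pmfI)
    fix f assume f: "f \<in> set_pmf (Pi_pmf A d q)"
    show "emeasure (map_pmf (?h f) (Pi_pmf B d q)) X \<le> ennreal e * indicator Y f"
    proof (cases "f \<in> Y")
      case True
      with Y[OF f] show ?thesis
        by (simp add: measure_pmf.emeasure_eq_measure vimage_def e)
    next
      case False
      then have "?h f -` X = {}" using nY[OF f] by auto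
      then show ?thesis by simp
    qed
  qed
  also have "\<dots> = ennreal (measure_pmf.prob (Pi_pmf A d q) Y * e)"
    using e by (simp add: nn_integral_cmult_indicator measure_pmf.emeasure_eq_measure ennreal_mult' mult.commute)
  finally show ?thesis
    using e by (simp add: measure_pmf.emeasure_eq_measure)
qed

lemma binomial_times_power_le:
  fixes q :: real
  assumes q: "0 \<le> q" and k: "6 * (N * q) \<le> k"
  shows "(N choose k) * q ^ k \<le> (1/2) ^ k"
proof -
  have "(N choose k) * (6 * q) ^ k \<le> (\<Sum>j\<le>N. (N choose j) * (6 * q) ^ j)"
  proof (cases "k \<le> N")
    case True
    then show ?thesis using q by (intro member_le_sum) auto
  next
    case False
    then show ?thesis using q by (simp add: sum_nonneg binomial_eq_0)
  qed
  also have "\<dots> = (6 * q + 1) ^ N" by (simp add: binomial_ring)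
  also have "\<dots> \<le> exp (6 * q) ^ N"
    using q exp_ge_add_one_self[of "6 * q"] by (intro power_mono) (auto simp: add.commute)
  also have "\<dots> = exp (6 * (N * q))" by (simp add: mult_ac flip: exp_of_nat_mult)
  also have "\<dots> \<le> exp (real k)" using k by simp
  also have "\<dots> = exp 1 ^ k" by (simp flip: exp_of_nat_mult)
  also have "\<dots> \<le> 3 ^ k" using exp_le by (intro power_mono) auto
  also have "(3::real) ^ k = (1/2) ^ k * 6 ^ k" by (simp flip: power_mult_distrib)
  also have "(N choose k) * (6 * q) ^ k = ((N choose k) * q ^ k) * 6 ^ k"
    by (simp only: power_mult_distrib mult_ac)
  finally have "((N choose k) * q ^ k) * 6 ^ k \<le> (1/2) ^ k * 6 ^ k" .
  then show ?thesis by simp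
qed

subsection \<open>Random labellings\<close>

lemma set_random_label_set:
  assumes "s \<in> set_pmf (random_label_set m p)"
  shows "s \<subseteq> {1..m}"
proof -
  obtain f where f: "f \<in> set_pmf (Pi_pmf {1..m} False (\<lambda>_. bernoulli_pmf p))" "s = {i. f i}"
    using assms unfolding random_label_set_def by auto
  then have "\<forall>i. i \<notin> {1..m} \<longrightarrow> f i = False"
    using set_Pi_pmf_subset[of "{1..m}" False "\<lambda>_. bernoulli_pmf p"] by blast
  with f(2) show ?thesis by blast
qed

lemma prob_random_label_set_superset:
  assumes p: "0 \<le> p" "p \<le> 1" and F: "F \<subseteq> {1..m}"
  shows "measure_pmf.prob (random_label_set m p) {s. F \<subseteq> s} \<le> p ^ card F"
proof -
  have "measure_pmf.prob (random_label_set m p) {s. F \<subseteq> s} =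
        measure_pmf.prob (Pi_pmf {1..m} False (\<lambda>_. bernoulli_pmf p)) {f. \<forall>i\<in>F. f i \<in> {True}}"
    unfolding random_label_set_def by (simp add: vimage_def subset_eq)
  also have "\<dots> \<le> p ^ card F"
    using F p by (intro prob_Pi_pmf_Ball_le) (auto simp: measure_pmf_single)
  finally show ?thesis .
qed

lemma prob_random_label_set_avoid:
  assumes p: "0 \<le> p" "p \<le> 1" and i: "i \<in> {1..m}" and F: "F \<subseteq> {1..m}"
  shows "p * (1 - p) ^ card F \<le> measure_pmf.prob (random_label_set m p) {s. i \<in> s \<and> s \<inter> F \<subseteq> {i}}"
proof -
  let ?B = "\<lambda>j. if j = i then {True} else if j \<in> F then {False} else UNIV"
  have fin: "finite F" using F finite_subset by blast
  have "{f. f i \<and> {i. f i} \<inter> F \<subseteq> {i}} = Pi {1..m} ?B"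
  proof (intro set_eqI iffI)
    fix f assume "f \<in> {f. f i \<and> {i. f i} \<inter> F \<subseteq> {i}}"
    then show "f \<in> Pi {1..m} ?B" by auto
  next
    fix f assume f: "f \<in> Pi {1..m} ?B"
    have "\<not> f j" if "j \<in> F" "j \<noteq> i" for j
      using Pi_mem[OF f, of j] that F by (auto simp: subset_eq)
    moreover have "f i" using Pi_mem[OF f i] by simp
    ultimately show "f \<in> {f. f i \<and> {i. f i} \<inter> F \<subseteq> {i}}" by blast
  qed
  then have "measure_pmf.prob (random_label_set m p) {s. i \<in> s \<and> s \<inter> F \<subseteq> {i}} =
        measure_pmf.prob (Pi_pmf {1..m} False (\<lambda>_. bernoulli_pmf p)) (Pi {1..m} ?B)"
    unfolding random_label_set_def by (simp add: vimage_def)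
  also have "\<dots> = (\<Prod>j\<in>{1..m}. measure_pmf.prob (bernoulli_pmf p) (?B j))"
    by (rule measure_Pi_pmf_Pi) simp
  also have "\<dots> = (\<Prod>j\<in>insert i (F - {i}). measure_pmf.prob (bernoulli_pmf p) (?B j))"
    using i F by (intro prod.mono_neutral_right) auto
  also have "\<dots> = p * (\<Prod>j\<in>F - {i}. measure_pmf.prob (bernoulli_pmf p) (?B j))"
    using fin p by (subst prod.insert) (auto simp: measure_pmf_single)
  also have "(\<Prod>j\<in>F - {i}. measure_pmf.prob (bernoulli_pmf p) (?B j)) = (\<Prod>j\<in>F - {i}. 1 - p)"
    using p by (intro prod.cong) (auto simp: measure_pmf_single)
  also have "\<dots> = (1 - p) ^ card (F - {i})" by simp
  finally have eq: "measure_pmf.prob (random_label_set m p) {s. i \<in> s \<and> s \<inter> F \<subseteq> {i}} =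
    p * (1 - p) ^ card (F - {i})" .
  have "(1 - p) ^ card F \<le> (1 - p) ^ card (F - {i})"
    using p fin by (intro power_decreasing card_mono) auto
  with p eq show ?thesis by (simp add: mult_left_mono)
qed

lemma prob_Pi_pmf_hit_all_le:
  assumes A: "finite A" and D: "finite D" and p: "0 \<le> p" "p \<le> 1"
    and R: "\<And>v. v \<in> D \<Longrightarrow> R v \<subseteq> A" "\<And>v w. v \<in> D \<Longrightarrow> w \<in> D \<Longrightarrow> v \<noteq> w \<Longrightarrow> R v \<inter> R w = {}"
    and c: "\<And>v. v \<in> D \<Longrightarrow> c \<le> (1 - p) ^ card (R v)" "c \<le> 1"
  shows "measure_pmf.prob (Pi_pmf A False (\<lambda>_. bernoulli_pmf p)) {f. \<forall>v\<in>D. \<exists>i\<in>R v. f i}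
          \<le> (1 - c) ^ card D"
  using D A R c(1)
proof (induction D arbitrary: A rule: finite_induct)
  case (insert v D)
  have Rv: "R v \<subseteq> A" using insert.prems(2) by simp
  have fRv: "finite (R v)" using Rv insert.prems(1) by (rule finite_subset)
  let ?q = "\<lambda>_::'a. bernoulli_pmf p"
  have "measure_pmf.prob (Pi_pmf (R v \<union> (A - R v)) False ?q) {f. \<forall>v\<in>insert v D. \<exists>i\<in>R v. f i}
      \<le> measure_pmf.prob (Pi_pmf (R v) False ?q) {f. \<exists>i\<in>R v. f i} * (1 - c) ^ card D"
  proof (rule prob_Pi_pmf_union_le)
    fix f :: "'a \<Rightarrow> bool"
    have sub: "R w \<subseteq> A - R v" if "w \<in> D" for w
      using insert.prems(2)[of w] insert.prems(3)[of w v] insert.hyps(2) that by blast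
    have "measure_pmf.prob (Pi_pmf (A - R v) False ?q)
        {g. (\<lambda>x. if x \<in> R v then f x else g x) \<in> {f. \<forall>v\<in>insert v D. \<exists>i\<in>R v. f i}}
      \<le> measure_pmf.prob (Pi_pmf (A - R v) False ?q) {g. \<forall>v\<in>D. \<exists>i\<in>R v. g i}"
    proof (intro measure_pmf.finite_measure_mono subsetI)
      fix g assume g: "g \<in> {g. (\<lambda>x. if x \<in> R v then f x else g x) \<in> {f. \<forall>v\<in>insert v D. \<exists>i\<in>R v. f i}}"
      show "g \<in> {g. \<forall>v\<in>D. \<exists>i\<in>R v. g i}"
      proof (intro CollectI ballI)
        fix w assume w: "w \<in> D"
        with g obtain i where "i \<in> R w" "if i \<in> R v then f i else g i" by auto
        moreover have "i \<notin> R v" using sub[OF w] \<open>i \<in> R w\<close> by blast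
        ultimately show "\<exists>i\<in>R w. g i" by auto
      qed
    qed simp
    also have "\<dots> \<le> (1 - c) ^ card D"
      using insert.prems sub by (intro insert.IH) auto
    finally show "measure_pmf.prob (Pi_pmf (A - R v) False ?q)
        {g. (\<lambda>x. if x \<in> R v then f x else g x) \<in> {f. \<forall>v\<in>insert v D. \<exists>i\<in>R v. f i}}
      \<le> (1 - c) ^ card D" .
  qed (use insert.prems(1) Rv fRv c(2) in auto)
  also have "R v \<union> (A - R v) = A" using Rv by blast
  also have "measure_pmf.prob (Pi_pmf (R v) False ?q) {f. \<exists>i\<in>R v. f i} =
      1 - measure_pmf.prob (Pi_pmf (R v) False ?q) (Pi (R v) (\<lambda>_. {False}))"
  proof -
    have "{f. \<exists>i\<in>R v. f i} = space (Pi_pmf (R v) False ?q) - Pi (R v) (\<lambda>_. {False})" by auto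
    then show ?thesis by (simp only:) (rule measure_pmf.prob_compl, simp)
  qed
  also have "\<dots> = 1 - (1 - p) ^ card (R v)"
    using p fRv by (subst measure_Pi_pmf_Pi) (auto simp: measure_pmf_single)
  also have "\<dots> * (1 - c) ^ card D \<le> (1 - c) * (1 - c) ^ card D"
    using insert.prems(4)[of v] c(2) by (intro mult_right_mono) auto
  finally show ?case using insert.hyps by simp
qed simp

lemma prob_random_label_set_hit_all:
  assumes D: "finite D" and p: "0 \<le> p" "p \<le> 1"
    and R: "\<And>v. v \<in> D \<Longrightarrow> R v \<subseteq> {1..m}" "\<And>v w. v \<in> D \<Longrightarrow> w \<in> D \<Longrightarrow> v \<noteq> w \<Longrightarrow> R v \<inter> R w = {}"
    and c: "\<And>v. v \<in> D \<Longrightarrow> c \<le> (1 - p) ^ card (R v)" "c \<le> 1"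
  shows "measure_pmf.prob (random_label_set m p) {s. \<forall>v\<in>D. s \<inter> R v \<noteq> {}} \<le> (1 - c) ^ card D"
proof -
  have "measure_pmf.prob (random_label_set m p) {s. \<forall>v\<in>D. s \<inter> R v \<noteq> {}} =
    measure_pmf.prob (Pi_pmf {1..m} False (\<lambda>_. bernoulli_pmf p)) {f. \<forall>v\<in>D. \<exists>i\<in>R v. f i}"
    unfolding random_label_set_def measure_map_pmf by (rule arg_cong[where f = "measure _"]) auto
  also have "\<dots> \<le> (1 - c) ^ card D" using assms by (intro prob_Pi_pmf_hit_all_le) auto
  finally show ?thesis .
qed

lemma prob_common_labels:
  fixes p :: real
  assumes p: "0 \<le> p" "p \<le> 1" and U: "U \<subseteq> {..<n}" and k: "6 * (m * p ^ card U) \<le> k"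
  shows "measure_pmf.prob (random_labelling n m p) {S. k \<le> card ({1..m} \<inter> (\<Inter>v\<in>U. S v))} \<le> (1/2) ^ k"
proof -
  let ?I = "{T. T \<subseteq> {1..m} \<and> card T = k}"
  have "measure_pmf.prob (random_labelling n m p) {S. k \<le> card ({1..m} \<inter> (\<Inter>v\<in>U. S v))}
      \<le> card ?I * (p ^ k) ^ card U"
  proof (rule prob_UN_le)
    show "finite ?I" by simp
    fix T assume T: "T \<in> ?I"
    show "measure_pmf.prob (random_labelling n m p) {S. \<forall>v\<in>U. S v \<in> {s. T \<subseteq> s}} \<le> (p ^ k) ^ card U"
      unfolding random_labelling_def
    proof (rule prob_Pi_pmf_Ball_le[OF _ U])
      show "measure_pmf.prob (random_label_set m p) {s. T \<subseteq> s} \<le> p ^ k"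
        using prob_random_label_set_superset[OF p, of T m] T by simp
    qed simp
  next
    show "{S. k \<le> card ({1..m} \<inter> (\<Inter>v\<in>U. S v))} \<subseteq> (\<Union>T\<in>?I. {S. \<forall>v\<in>U. S v \<in> {s. T \<subseteq> s}})"
    proof
      fix S assume "S \<in> {S. k \<le> card ({1..m} \<inter> (\<Inter>v\<in>U. S v))}"
      then have "k \<le> card ({1..m} \<inter> (\<Inter>v\<in>U. S v))" by simp
      then obtain T where "T \<subseteq> {1..m} \<inter> (\<Inter>v\<in>U. S v)" "card T = k"
        by (rule obtain_subset_with_card_n)
      then show "S \<in> (\<Union>T\<in>?I. {S. \<forall>v\<in>U. S v \<in> {s. T \<subseteq> s}})" by auto
    qed
  qed
  also have "card ?I = m choose k" using n_subsets[of "{1..m}" k] by simp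
  also have "(m choose k) * (p ^ k) ^ card U = (m choose k) * (p ^ card U) ^ k"
    by (simp add: mult.commute flip: power_mult)
  also have "\<dots> \<le> (1/2) ^ k" using p k by (intro binomial_times_power_le) auto
  finally show ?thesis .
qed

lemma prob_common_vertices:
  fixes p :: real
  assumes p: "0 \<le> p" "p \<le> 1" and F: "F \<subseteq> {1..m}" and k: "6 * (n * p ^ card F) \<le> k"
  shows "measure_pmf.prob (random_labelling n m p) {S. k \<le> card {v. v < n \<and> F \<subseteq> S v}} \<le> (1/2) ^ k"
proof -
  have "measure_pmf.prob (random_labelling n m p) {S. k \<le> card {v. v < n \<and> F \<subseteq> S v}} =
    measure_pmf.prob (Pi_pmf {..<n} {} (\<lambda>_. random_label_set m p))
      {S. k \<le> card {v\<in>{..<n}. S v \<in> {s. F \<subseteq> s}}}"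
    by (simp add: random_labelling_def)
  also have "\<dots> \<le> (card {..<n} choose k) * (p ^ card F) ^ k"
    by (intro prob_Pi_pmf_count_ge prob_random_label_set_superset p F) simp
  also have "\<dots> = (n choose k) * (p ^ card F) ^ k" by simp
  also have "\<dots> \<le> (1/2) ^ k" using p k by (intro binomial_times_power_le) auto
  finally show ?thesis .
qed

lemma set_random_labels_Pi_pmf:
  assumes "f \<in> set_pmf (Pi_pmf A {} (\<lambda>_. random_label_set m p))" "finite A"
  shows "f v \<subseteq> {1..m}"
proof (cases "v \<in> A")
  case True
  then have "f v \<in> set_pmf (random_label_set m p)"
    using assms set_Pi_pmf[of A "{}" "\<lambda>_. random_label_set m p"] by (auto simp: PiE_dflt_def)
  then show ?thesis by (rule set_random_label_set)
next
  case False
  then show ?thesis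
    using assms set_Pi_pmf[of A "{}" "\<lambda>_. random_label_set m p"] by (auto simp: PiE_dflt_def)
qed

lemma prob_private_neighbours:
  fixes p :: real
  assumes p: "0 \<le> p" "p \<le> 1" and i: "i \<in> {1..m}" and v: "v < n"
    and c: "0 \<le> c" "c \<le> (1 - p) ^ l"
  shows "measure_pmf.prob (random_labelling n m p)
      {S. card (S v) \<le> l \<and> real (card (private_neighbours n S i v)) \<le> p * c * (n - 1) / 4}
      \<le> exp (- (p * c * (n - 1) / 4))" (is "_ \<le> ?e")
proof -
  let ?q = "\<lambda>_. random_label_set m p" and ?B = "{..<n} - {v}"
  let ?X = "{S. card (S v) \<le> l \<and> real (card (private_neighbours n S i v)) \<le> p * c * (n - 1) / 4}"
  have V: "{..<n} = {v} \<union> ?B" using v by auto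
  have cB: "card ?B = n - 1" using v by simp
  have "measure_pmf.prob (Pi_pmf ({v} \<union> ?B) {} ?q) ?X
      \<le> measure_pmf.prob (Pi_pmf {v} {} ?q) {f. card (f v) \<le> l} * ?e"
  proof (rule prob_Pi_pmf_union_le)
    fix f assume f: "f \<in> set_pmf (Pi_pmf {v} {} ?q)" "f \<in> {f. card (f v) \<le> l}"
    let ?E = "{s. i \<in> s \<and> s \<inter> f v \<subseteq> {i}}"
    have fv: "f v \<subseteq> {1..m}" using set_random_labels_Pi_pmf[OF f(1)] by simp
    have "c \<le> (1 - p) ^ card (f v)"
      using c(2) p f(2) by (elim order_trans) (auto intro!: power_decreasing)
    then have "p * c \<le> p * (1 - p) ^ card (f v)" using p by (intro mult_left_mono) auto
    also have "\<dots> \<le> measure_pmf.prob (random_label_set m p) ?E"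
      by (rule prob_random_label_set_avoid[OF p i fv])
    finally have E: "p * c \<le> measure_pmf.prob (random_label_set m p) ?E" .
    have priv: "private_neighbours n (\<lambda>x. if x \<in> {v} then f x else g x) i v = {u\<in>?B. g u \<in> ?E}" for g
      unfolding private_neighbours_def by auto
    have "measure_pmf.prob (Pi_pmf ?B {} ?q) {g. (\<lambda>x. if x \<in> {v} then f x else g x) \<in> ?X}
      \<le> measure_pmf.prob (Pi_pmf ?B {} ?q) {g. real (card {u\<in>?B. g u \<in> ?E}) \<le> p * c * card ?B / 4}"
      unfolding mem_Collect_eq priv cB by (intro measure_pmf.finite_measure_mono) auto
    also have "\<dots> \<le> exp (- (p * c * card ?B / 4))"
      using E p c by (intro prob_Pi_pmf_count_le) auto
    finally show "measure_pmf.prob (Pi_pmf ?B {} ?q) {g. (\<lambda>x. if x \<in> {v} then f x else g x) \<in> ?X} \<le> ?e"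
      unfolding cB .
  qed auto
  also have "\<dots> \<le> 1 * ?e" by (intro mult_right_mono) auto
  finally show ?thesis unfolding random_labelling_def using V by simp
qed

lemma prob_scattered_neighbours:
  fixes p :: real
  assumes p: "0 \<le> p" "p \<le> 1" and D: "D \<subseteq> {..<n}"
    and c: "c \<le> 1" "c \<le> (1 - p) ^ l"
  shows "measure_pmf.prob (random_labelling n m p)
      {S. (\<forall>v\<in>D. card (S v) \<le> l) \<and> k \<le> card (scattered_neighbours n S D)}
      \<le> real n ^ k * (1 - c) ^ (card D * k)" (is "_ \<le> ?e")
proof -
  let ?q = "\<lambda>_. random_label_set m p" and ?B = "{..<n} - D"
  let ?X = "{S. (\<forall>v\<in>D. card (S v) \<le> l) \<and> k \<le> card (scattered_neighbours n S D)}"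
  have V: "{..<n} = D \<union> ?B" using D by auto
  have fD: "finite D" using D finite_subset by blast
  have e0: "0 \<le> ?e" using c by simp
  have "measure_pmf.prob (Pi_pmf (D \<union> ?B) {} ?q) ?X
      \<le> measure_pmf.prob (Pi_pmf D {} ?q) {f. \<forall>v\<in>D. card (f v) \<le> l} * ?e"
  proof (rule prob_Pi_pmf_union_le)
    fix f assume f: "f \<in> set_pmf (Pi_pmf D {} ?q)" "f \<in> {f. \<forall>v\<in>D. card (f v) \<le> l}"
    let ?R = "\<lambda>v. f v - repeated_labels f D"
    let ?E = "{s. \<forall>v\<in>D. s \<inter> ?R v \<noteq> {}}"
    have fv: "f v \<subseteq> {1..m}" for v by (rule set_random_labels_Pi_pmf[OF f(1) fD])
    have E: "measure_pmf.prob (random_label_set m p) ?E \<le> (1 - c) ^ card D"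
    proof (rule prob_random_label_set_hit_all[OF fD p])
      show "?R v \<subseteq> {1..m}" for v using fv by blast
      show "?R v \<inter> ?R w = {}" if "v \<in> D" "w \<in> D" "v \<noteq> w" for v w
        using that unfolding repeated_labels_def by blast
      fix v assume v: "v \<in> D"
      have "card (?R v) \<le> card (f v)" using fv[of v] finite_subset by (intro card_mono) auto
      then have "card (?R v) \<le> l" using f(2) v by fastforce
      then show "c \<le> (1 - p) ^ card (?R v)"
        using c(2) p by (elim order_trans) (auto intro!: power_decreasing)
    qed (rule c)
    have rep: "repeated_labels (\<lambda>x. if x \<in> D then f x else g x) D = repeated_labels f D" for g
      unfolding repeated_labels_def by (intro Collect_cong bex_cong refl) simp
    have scat: "scattered_neighbours n (\<lambda>x. if x \<in> D then f x else g x) D = {u\<in>?B. g u \<in> ?E}" for g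
      unfolding scattered_neighbours_def rep by auto
    have "measure_pmf.prob (Pi_pmf ?B {} ?q) {g. (\<lambda>x. if x \<in> D then f x else g x) \<in> ?X}
      \<le> measure_pmf.prob (Pi_pmf ?B {} ?q) {g. k \<le> card {u\<in>?B. g u \<in> ?E}}"
      unfolding mem_Collect_eq scat by (intro measure_pmf.finite_measure_mono) auto
    also have "\<dots> \<le> (card ?B choose k) * ((1 - c) ^ card D) ^ k"
      using E by (intro prob_Pi_pmf_count_ge) auto
    also have "\<dots> \<le> real n ^ k * ((1 - c) ^ card D) ^ k"
    proof (rule mult_right_mono)
      have "card ?B choose k \<le> card ?B ^ k"
        by (cases "k \<le> card ?B") (simp_all add: binomial_le_pow binomial_eq_0)
      also have "\<dots> \<le> n ^ k"
        using card_mono[of "{..<n}" ?B] by (intro power_mono) auto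
      finally show "real (card ?B choose k) \<le> real n ^ k" by (simp flip: of_nat_power)
    qed (use c in auto)
    finally show "measure_pmf.prob (Pi_pmf ?B {} ?q) {g. (\<lambda>x. if x \<in> D then f x else g x) \<in> ?X} \<le> ?e"
      by (simp add: power_mult)
  qed (use fD e0 in auto)
  also have "\<dots> \<le> 1 * ?e" using e0 by (intro mult_right_mono) auto
  finally show ?thesis unfolding random_labelling_def using V by simp
qed

lemma typical_labellingI:
  fixes a :: real and k h l :: nat
  assumes labels: "\<And>v. S v \<subseteq> {1..m}"
    and X1: "\<And>v w. v < n \<Longrightarrow> w < n \<Longrightarrow> v \<noteq> w \<Longrightarrow> card ({1..m} \<inter> (\<Inter>x\<in>{v, w}. S x)) < r"
    and X2: "\<And>v. v < n \<Longrightarrow> card ({1..m} \<inter> (\<Inter>x\<in>{v}. S x)) < l"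
    and X3: "\<And>i j. i \<in> {1..m} \<Longrightarrow> j \<in> {1..m} \<Longrightarrow> i \<noteq> j \<Longrightarrow> card {v. v < n \<and> {i, j} \<subseteq> S v} < k"
    and X4: "\<And>i. i \<in> {1..m} \<Longrightarrow> card {v. v < n \<and> {i} \<subseteq> S v} < h"
    and X5: "\<And>i v. i \<in> {1..m} \<Longrightarrow> v < n \<Longrightarrow>
               \<not> (card (S v) \<le> l \<and> card (private_neighbours n S i v) \<le> a)"
    and X6: "\<And>D. D \<subseteq> {..<n} \<Longrightarrow> card D = r \<Longrightarrow>
               \<not> ((\<forall>v\<in>D. card (S v) \<le> l) \<and> 2 * r \<le> card (scattered_neighbours n S D))"
    and "0 < r" "real r ^ 3 * (2 * r + real r ^ 3 * k) + 3 * r < a" "2 * r * (h + r) * (real h)\<^sup>2 < a ^ 4"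
  shows "typical_labelling n m r S a h k"
proof
  have l: "card (S v) \<le> l" if "v < n" for v
  proof -
    have "{1..m} \<inter> (\<Inter>x\<in>{v}. S x) = S v" using labels[of v] by auto
    with X2[OF that] show ?thesis by simp
  qed
  show "card (S v \<inter> S w) \<le> r" if "v < n" "w < n" "v \<noteq> w" for v w
  proof -
    have "{1..m} \<inter> (\<Inter>x\<in>{v, w}. S x) = S v \<inter> S w" using labels[of v] by auto
    with X1[OF that] show ?thesis by simp
  qed
  show "real (card (label_class n S i \<inter> label_class n S j)) \<le> real k"
    if "i \<in> {1..m}" "j \<in> {1..m}" "i \<noteq> j" for i j
  proof -
    have "{v. v < n \<and> {i, j} \<subseteq> S v} = label_class n S i \<inter> label_class n S j"
      by (auto simp: label_class_def)
    with X3[OF that] show ?thesis by simp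
  qed
  show "real (card (label_class n S i)) \<le> real h" if "i \<in> {1..m}" for i
    using X4[OF that] by (simp add: label_class_def)
  show "a \<le> real (card (private_neighbours n S i v))" if "i \<in> {1..m}" "v < n" for i v
    using X5[OF that] l[OF that(2)] by linarith
  show "card (scattered_neighbours n S D) < 2 * r" if "D \<subseteq> {..<n}" "card D = r" for D
    using X6[OF that] l that(1) by (meson lessThan_iff not_less subsetD)
qed (use assms in auto)

lemma prob_typical_labelling:
  fixes a c p :: real and k h l n m r :: nat
  defines "a \<equiv> p * c * (n - 1) / 4"
  assumes p: "0 \<le> p" "p \<le> 1" and c: "0 \<le> c" "c \<le> 1" "c \<le> (1 - p) ^ l"
    and r: "0 < r" "6 * (m * p\<^sup>2) \<le> r" and l: "6 * (m * p) \<le> l" "r \<le> l"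
    and k: "6 * (n * p\<^sup>2) \<le> k" "r \<le> k" and h: "6 * (n * p) \<le> h" "r \<le> h"
    and a: "real r ^ 3 * (2 * r + real r ^ 3 * k) + 3 * r < a" "2 * r * (h + r) * (real h)\<^sup>2 < a ^ 4"
  shows "1 - ((n\<^sup>2 + n + m\<^sup>2 + m) * (1/2) ^ r + n * m * exp (- a) + (real n ^ 3 * (1 - c) ^ (2 * r)) ^ r)
    \<le> measure_pmf.prob (random_labelling n m p) {S. typical_labelling n m r S a h k}"
proof -
  let ?M = "random_labelling n m p"
  let ?I1 = "{(v, w). v < n \<and> w < n \<and> v \<noteq> w}" and ?I3 = "{(i, j). i \<in> {1..m} \<and> j \<in> {1..m} \<and> i \<noteq> j}"
    and ?I6 = "{D. D \<subseteq> {..<n} \<and> card D = r}"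
  let ?X1 = "\<Union>(v, w)\<in>?I1. {S. r \<le> card ({1..m} \<inter> (\<Inter>x\<in>{v, w}. S x))}"
    and ?X2 = "\<Union>v\<in>{..<n}. {S. l \<le> card ({1..m} \<inter> (\<Inter>x\<in>{v}. S x))}"
    and ?X3 = "\<Union>(i, j)\<in>?I3. {S. k \<le> card {v. v < n \<and> {i, j} \<subseteq> S v}}"
    and ?X4 = "\<Union>i\<in>{1..m}. {S. h \<le> card {v. v < n \<and> {i} \<subseteq> S v}}"
    and ?X5 = "\<Union>(i, v)\<in>{1..m} \<times> {..<n}. {S. card (S v) \<le> l \<and> card (private_neighbours n S i v) \<le> a}"
    and ?X6 = "\<Union>D\<in>?I6. {S. (\<forall>v\<in>D. card (S v) \<le> l) \<and> 2 * r \<le> card (scattered_neighbours n S D)}"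
  have half: "(1/2) ^ j \<le> (1/2 :: real) ^ r" if "r \<le> j" for j using that by (intro power_decreasing) auto
  have sub1: "?I1 \<subseteq> {..<n} \<times> {..<n}" and sub3: "?I3 \<subseteq> {1..m} \<times> {1..m}" by auto
  have fin: "finite ?I1" "finite ?I3" using sub1 sub3 by (auto intro: finite_subset)
  have card1: "card ?I1 \<le> n\<^sup>2" using card_mono[OF _ sub1] by (simp add: card_cartesian_product power2_eq_square)
  have card3: "card ?I3 \<le> m\<^sup>2" using card_mono[OF _ sub3] by (simp add: card_cartesian_product power2_eq_square)
  have P1: "measure_pmf.prob ?M ?X1 \<le> n\<^sup>2 * (1/2) ^ r"
  proof -
    have "measure_pmf.prob ?M ?X1 \<le> card ?I1 * (1/2) ^ r"
    proof (rule prob_UN_le[OF fin(1) _ order.refl], clarify)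
      fix v w assume "v < n" "w < n" "v \<noteq> w"
      then show "measure_pmf.prob ?M {S. r \<le> card ({1..m} \<inter> (\<Inter>x\<in>{v, w}. S x))} \<le> (1/2) ^ r"
        using r p by (intro prob_common_labels) (auto simp: power2_eq_square)
    qed
    also have "\<dots> \<le> n\<^sup>2 * (1/2) ^ r" using card1 by (intro mult_right_mono of_nat_mono) auto
    finally show ?thesis .
  qed
  have P2: "measure_pmf.prob ?M ?X2 \<le> n * (1/2) ^ r"
  proof -
    have "measure_pmf.prob ?M ?X2 \<le> card {..<n} * (1/2) ^ r"
    proof (rule prob_UN_le[OF _ _ order.refl])
      fix v assume "v \<in> {..<n}"
      then have "measure_pmf.prob ?M {S. l \<le> card ({1..m} \<inter> (\<Inter>x\<in>{v}. S x))} \<le> (1/2) ^ l"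
        using l p by (intro prob_common_labels) auto
      with half[OF l(2)] show "measure_pmf.prob ?M {S. l \<le> card ({1..m} \<inter> (\<Inter>x\<in>{v}. S x))} \<le> (1/2) ^ r"
        by linarith
    qed simp
    then show ?thesis by simp
  qed
  have P3: "measure_pmf.prob ?M ?X3 \<le> m\<^sup>2 * (1/2) ^ r"
  proof -
    have "measure_pmf.prob ?M ?X3 \<le> card ?I3 * (1/2) ^ r"
    proof (rule prob_UN_le[OF fin(2) _ order.refl], clarify)
      fix i j assume "i \<in> {1..m}" "j \<in> {1..m}" "i \<noteq> j"
      then have "measure_pmf.prob ?M {S. k \<le> card {v. v < n \<and> {i, j} \<subseteq> S v}} \<le> (1/2) ^ k"
        using k p by (intro prob_common_vertices) (auto simp: power2_eq_square)
      with half[OF k(2)] show "measure_pmf.prob ?M {S. k \<le> card {v. v < n \<and> {i, j} \<subseteq> S v}} \<le> (1/2) ^ r"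
        by linarith
    qed
    also have "\<dots> \<le> m\<^sup>2 * (1/2) ^ r" using card3 by (intro mult_right_mono of_nat_mono) auto
    finally show ?thesis .
  qed
  have P4: "measure_pmf.prob ?M ?X4 \<le> m * (1/2) ^ r"
  proof -
    have "measure_pmf.prob ?M ?X4 \<le> card {1..m} * (1/2) ^ r"
    proof (rule prob_UN_le[OF _ _ order.refl])
      fix i assume "i \<in> {1..m}"
      then have "measure_pmf.prob ?M {S. h \<le> card {v. v < n \<and> {i} \<subseteq> S v}} \<le> (1/2) ^ h"
        using h p by (intro prob_common_vertices) auto
      with half[OF h(2)] show "measure_pmf.prob ?M {S. h \<le> card {v. v < n \<and> {i} \<subseteq> S v}} \<le> (1/2) ^ r"
        by linarith
    qed simp
    then show ?thesis by simp
  qed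
  have P5: "measure_pmf.prob ?M ?X5 \<le> n * m * exp (- a)"
  proof -
    have "measure_pmf.prob ?M ?X5 \<le> card ({1..m} \<times> {..<n}) * exp (- a)"
    proof (rule prob_UN_le[OF _ _ order.refl])
      fix x assume "x \<in> {1..m} \<times> {..<n}"
      then obtain i v where x: "x = (i, v)" "i \<in> {1..m}" "v < n" by blast
      show "measure_pmf.prob ?M (case x of (i, v) \<Rightarrow>
          {S. card (S v) \<le> l \<and> card (private_neighbours n S i v) \<le> a}) \<le> exp (- a)"
        unfolding a_def x(1) prod.case using p c x by (intro prob_private_neighbours) auto
    qed simp
    then show ?thesis by (simp add: card_cartesian_product mult_ac)
  qed
  have P6: "measure_pmf.prob ?M ?X6 \<le> (real n ^ 3 * (1 - c) ^ (2 * r)) ^ r"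
  proof -
    have "measure_pmf.prob ?M ?X6 \<le> card ?I6 * (real n ^ (2 * r) * (1 - c) ^ (r * (2 * r)))"
    proof (rule prob_UN_le[OF _ _ order.refl])
      fix D assume "D \<in> ?I6"
      then show "measure_pmf.prob ?M {S. (\<forall>v\<in>D. card (S v) \<le> l) \<and> 2 * r \<le> card (scattered_neighbours n S D)}
          \<le> real n ^ (2 * r) * (1 - c) ^ (r * (2 * r))"
        using prob_scattered_neighbours[OF p, of D n c l m "2 * r"] c by auto
    qed simp
    also have "\<dots> \<le> real n ^ r * (real n ^ (2 * r) * (1 - c) ^ (r * (2 * r)))"
    proof (rule mult_right_mono)
      have "card ?I6 = n choose r" using n_subsets[of "{..<n}" r] by simp
      also have "\<dots> \<le> n ^ r" by (cases "r \<le> n") (simp_all add: binomial_le_pow binomial_eq_0)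
      finally show "real (card ?I6) \<le> real n ^ r" by (simp flip: of_nat_power)
    qed (use c in auto)
    also have "\<dots> = (real n ^ 3 * (1 - c) ^ (2 * r)) ^ r"
      by (simp add: power_mult_distrib mult_ac flip: power_mult power_add)
    finally show ?thesis .
  qed
  let ?X = "?X1 \<union> ?X2 \<union> ?X3 \<union> ?X4 \<union> ?X5 \<union> ?X6"
  have "AE S in ?M. S \<in> UNIV - ?X \<longrightarrow> S \<in> {S. typical_labelling n m r S a h k}"
  proof (rule AE_pmfI, rule impI)
    fix S assume S: "S \<in> set_pmf ?M" and X: "S \<in> UNIV - ?X"
    show "S \<in> {S. typical_labelling n m r S a h k}"
      unfolding mem_Collect_eq
    proof (rule typical_labellingI[where l = l])
      show "S v \<subseteq> {1..m}" for v
        using set_random_labels_Pi_pmf[OF S[unfolded random_labelling_def]] by simp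
      show "card {v. v < n \<and> {i, j} \<subseteq> S v} < k" if "i \<in> {1..m}" "j \<in> {1..m}" "i \<noteq> j" for i j
      proof (rule ccontr)
        assume "\<not> ?thesis"
        then have "S \<in> ?X3" using that by (intro UN_I[of "(i, j)"]) auto
        with X show False by blast
      qed
    qed (use X r a in \<open>auto simp: not_le\<close>)
  qed
  then have "measure_pmf.prob ?M (UNIV - ?X) \<le> measure_pmf.prob ?M {S. typical_labelling n m r S a h k}"
    by (intro measure_pmf.finite_measure_mono_AE) auto
  moreover have "measure_pmf.prob ?M (UNIV - ?X) = 1 - measure_pmf.prob ?M ?X"
    using measure_pmf.prob_compl[of ?X ?M] by simp
  moreover have "measure_pmf.prob ?M ?X \<le> measure_pmf.prob ?M ?X1 + measure_pmf.prob ?M ?X2 +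
      measure_pmf.prob ?M ?X3 + measure_pmf.prob ?M ?X4 + measure_pmf.prob ?M ?X5 + measure_pmf.prob ?M ?X6"
    by (intro order_trans[OF measure_Un_le] add_mono order.refl) auto
  ultimately show ?thesis using P1 P2 P3 P4 P5 P6 by (simp add: distrib_right)
qed

lemma exp_le_one_minus_power:
  fixes p :: real
  assumes "0 \<le> p" "p \<le> 1/2"
  shows "exp (- (2 * (l * p))) \<le> (1 - p) ^ l"
proof -
  have "p * p \<le> p * (1/2)" using assms by (intro mult_left_mono) auto
  then have "1 \<le> (1 - p) * (1 + 2 * p)" by (simp add: algebra_simps)
  also have "\<dots> \<le> (1 - p) * exp (2 * p)"
    using assms exp_ge_add_one_self[of "2 * p"] by (intro mult_left_mono) auto
  finally have "exp (- (2 * p)) \<le> 1 - p" by (simp add: exp_minus field_simps)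
  then have "exp (- (2 * p)) ^ l \<le> (1 - p) ^ l" by (intro power_mono) auto
  also have "exp (- (2 * p)) ^ l = exp (- (2 * (l * p)))"
    by (simp add: mult_ac flip: exp_of_nat_mult)
  finally show ?thesis .
qed

text \<open>The constant \<open>c\<close> is a lower bound for the probability that a random label set avoids a given
  set of at most \<open>6 m p + r + 1\<close> labels.\<close>

lemma prob_uniquely_determined_ge:
  fixes c C p :: real and n m r :: nat
  defines "c \<equiv> exp (- (2 * (6 * C + 2)))"
  assumes n: "2 \<le> n" and m: "m \<le> 2 * n" and p: "0 \<le> p" "p \<le> 1/2" and C: "0 \<le> C" "m * p\<^sup>2 \<le> C"
    and r: "1 \<le> r" "6 * C \<le> r" and rp: "200 * (real r ^ 7 * p) \<le> c"
    and rn: "5000000 * real r ^ 7 \<le> c ^ 4 * (n * p)" and rc: "(real n)\<^sup>2 * exp (- (c * r)) \<le> 1"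
  shows "1 - (10 * (real n)\<^sup>2 * (1/2) ^ r + 1 / n) \<le> measure_pmf.prob (random_labelling n m p)
           {S. uniquely_determined n m p (intersection_graph n S) (assoc_bipartite n S)}"
proof -
  define N where "N = n * p"
  define l where "l = nat \<lceil>6 * (m * p)\<rceil> + r"
  define k where "k = nat \<lceil>6 * (n * p\<^sup>2)\<rceil> + r"
  define h where "h = nat \<lceil>6 * (n * p)\<rceil> + r"
  define a where "a = p * c * (n - 1) / 4"
  have c: "0 < c" "c \<le> 1" using C by (auto simp: c_def)
  have r1: "1 \<le> real r" using r by simp
  have r7: "real r ^ j \<le> real r ^ 7" if "j \<le> 7" for j using r1 that by (intro power_increasing) auto
  have r_le: "real r \<le> real r ^ 7" using r7[of 1] by simp
  have c4: "c ^ 4 \<le> c" using c power_decreasing[of 1 4 c] by simp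
  have N0: "0 \<le> N" using p by (simp add: N_def)
  have cN: "5000000 * real r ^ 7 \<le> c * N"
    using rn mult_right_mono[OF c4 N0] by (simp add: N_def)
  have "c * N \<le> N" using mult_right_mono[OF c(2) N0] by simp
  with cN r_le r1 have N: "5000000 * real r \<le> N" by linarith
  have ceil: "real (nat \<lceil>x\<rceil>) \<le> x + 1" if "0 \<le> x" for x :: real using that by linarith
  have lp: "real l * p \<le> 6 * C + 2"
  proof -
    have "real l \<le> 6 * (m * p) + 1 + r" using ceil[of "6 * (m * p)"] p by (simp add: l_def)
    then have "real l * p \<le> (6 * (m * p) + 1 + r) * p" using p by (intro mult_right_mono) auto
    also have "\<dots> = 6 * (m * p\<^sup>2) + p + r * p" by (simp add: algebra_simps power2_eq_square)
    also have "real r * p \<le> real r ^ 7 * p" using r_le p by (intro mult_right_mono) auto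
    finally show ?thesis using C p rp c by linarith
  qed
  have cl: "c \<le> (1 - p) ^ l"
  proof -
    have "c \<le> exp (- (2 * (l * p)))" using lp by (simp add: c_def)
    also have "\<dots> \<le> (1 - p) ^ l" using p by (rule exp_le_one_minus_power)
    finally show ?thesis .
  qed
  have k_le: "real k \<le> 6 * (N * p) + 1 + r"
    using ceil[of "6 * (n * p\<^sup>2)"] p by (simp add: k_def N_def power2_eq_square mult_ac)
  have h_le: "real h \<le> 8 * N"
  proof -
    have "real h \<le> 6 * N + 1 + r" using ceil[of "6 * (n * p)"] p by (simp add: h_def N_def)
    then show ?thesis using N r1 by linarith
  qed
  have a_ge: "c * N / 8 \<le> a"
  proof -
    have "real n / 2 \<le> real (n - 1)" using n by linarith
    then have "p * c / 4 * (real n / 2) \<le> p * c / 4 * real (n - 1)"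
      using p c by (intro mult_left_mono) auto
    then show ?thesis by (simp add: a_def N_def mult_ac)
  qed
  have a1: "real r ^ 3 * (2 * r + real r ^ 3 * k) + 3 * r < a"
  proof -
    have "real r ^ 3 * (2 * r + real r ^ 3 * k) + 3 * r = 2 * real r ^ 4 + real r ^ 6 * k + 3 * r"
      by (simp add: algebra_simps power_numeral_reduce)
    also have "real r ^ 6 * k \<le> real r ^ 6 * (6 * (N * p) + 1 + r)"
      using k_le by (intro mult_left_mono) auto
    also have "\<dots> = 6 * N * (real r ^ 6 * p) + real r ^ 6 + real r ^ 7"
      by (simp add: algebra_simps power_numeral_reduce)
    also have "6 * N * (real r ^ 6 * p) \<le> 6 * N * (c / 200)"
    proof (rule mult_left_mono)
      have "real r ^ 6 * p \<le> real r ^ 7 * p" using r7[of 6] p by (intro mult_right_mono) auto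
      with rp show "real r ^ 6 * p \<le> c / 200" by linarith
    qed (use N0 in auto)
    also have "6 * N * (c / 200) = 6 * (c * N) / 200" by simp
    finally have "real r ^ 3 * (2 * r + real r ^ 3 * k) + 3 * r
        \<le> 2 * real r ^ 4 + (6 * (c * N) / 200 + real r ^ 6 + real r ^ 7) + 3 * r" by simp
    also have "\<dots> < c * N / 8" using r7[of 4] r7[of 6] r_le cN r1 by linarith
    finally show ?thesis using a_ge by linarith
  qed
  have a2: "2 * r * (h + r) * (real h)\<^sup>2 < a ^ 4"
  proof -
    have Npos: "0 < N" using N r1 by linarith
    have "2 * r * (h + r) * (real h)\<^sup>2 \<le> 2 * r * (9 * N) * (8 * N)\<^sup>2"
      using h_le N r1 by (intro mult_mono power_mono) auto
    also have "\<dots> = 1152 * real r * N ^ 3" by (simp add: algebra_simps power_numeral_reduce)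
    also have "\<dots> < (c ^ 4 * N / 4096) * N ^ 3"
    proof (rule mult_strict_right_mono)
      have "5000000 * real r \<le> c ^ 4 * N" using rn r_le unfolding N_def by linarith
      then show "1152 * real r < c ^ 4 * N / 4096" using r1 by linarith
    qed (use Npos in simp)
    also have "\<dots> = (c * N / 8) ^ 4" by (simp add: algebra_simps power_numeral_reduce)
    also have "\<dots> \<le> a ^ 4" using a_ge c N0 by (intro power_mono) auto
    finally show ?thesis by simp
  qed
  have e5: "n * m * exp (- a) \<le> 2 * (real n)\<^sup>2 * (1/2) ^ r"
  proof -
    have half: "exp (- 1) \<le> (1/2 :: real)"
      using exp_ge_add_one_self[of 1] by (simp add: exp_minus field_simps)
    have "real r \<le> a" using a_ge cN r_le r1 by linarith
    then have "exp (- a) \<le> exp (- real r)" by simp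
    also have "\<dots> = exp (- 1) ^ r" by (simp flip: exp_of_nat_mult)
    also have "\<dots> \<le> (1/2) ^ r" using half by (intro power_mono) auto
    finally have e: "exp (- a) \<le> (1/2) ^ r" .
    have "real (n * m) \<le> real (n * (2 * n))" using m by (intro of_nat_mono mult_left_mono) auto
    also have "\<dots> = 2 * (real n)\<^sup>2" by (simp add: power2_eq_square)
    finally have "real (n * m) \<le> 2 * (real n)\<^sup>2" .
    with e show ?thesis by (intro mult_mono) auto
  qed
  have e14: "(n\<^sup>2 + n + m\<^sup>2 + m) * (1/2) ^ r \<le> 8 * (real n)\<^sup>2 * (1/2) ^ r"
  proof (rule mult_right_mono)
    have "m * m \<le> (2 * n) * (2 * n)" using m by (intro mult_mono) auto
    moreover have "n * 2 \<le> n * n" using n by (intro mult_left_mono) auto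
    ultimately have "n\<^sup>2 + n + m\<^sup>2 + m \<le> 8 * n\<^sup>2" using m unfolding power2_eq_square by linarith
    then have "real (n\<^sup>2 + n + m\<^sup>2 + m) \<le> real (8 * n\<^sup>2)" by (rule of_nat_mono)
    then show "real (n\<^sup>2 + n + m\<^sup>2 + m) \<le> 8 * (real n)\<^sup>2" by simp
  qed simp
  have e6: "(real n ^ 3 * (1 - c) ^ (2 * r)) ^ r \<le> 1 / n"
  proof -
    have n0: "0 < real n" using n by simp
    have "1 - c \<le> exp (- c)" using exp_ge_add_one_self[of "- c"] by simp
    then have "(1 - c) ^ r \<le> exp (- c) ^ r" using c by (intro power_mono) auto
    also have "\<dots> = exp (- (c * r))" by (simp add: mult_ac flip: exp_of_nat_mult)
    finally have "(real n)\<^sup>2 * (1 - c) ^ r \<le> (real n)\<^sup>2 * exp (- (c * r))"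
      by (intro mult_left_mono) auto
    with rc have "(real n)\<^sup>2 * (1 - c) ^ r \<le> 1" by linarith
    then have "((real n)\<^sup>2 * (1 - c) ^ r)\<^sup>2 \<le> 1" using c by (intro power_le_one) auto
    then have "real n * (real n ^ 3 * (1 - c) ^ (2 * r)) \<le> 1"
      unfolding power_even_eq by (simp add: power_numeral_reduce mult_ac)
    then have le: "real n ^ 3 * (1 - c) ^ (2 * r) \<le> 1 / n" using n0 by (simp add: field_simps)
    then have "(real n ^ 3 * (1 - c) ^ (2 * r)) ^ r \<le> (1 / n) ^ r" using c by (intro power_mono) auto
    also have "\<dots> \<le> (1 / n) ^ 1" using r n0 by (intro power_decreasing) auto
    finally show ?thesis by simp
  qed
  have "1 - ((n\<^sup>2 + n + m\<^sup>2 + m) * (1/2) ^ r + n * m * exp (- a) + (real n ^ 3 * (1 - c) ^ (2 * r)) ^ r)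
      \<le> measure_pmf.prob (random_labelling n m p) {S. typical_labelling n m r S a h k}"
    unfolding a_def
  proof (rule prob_typical_labelling)
    show "6 * (m * p\<^sup>2) \<le> r" using C r by linarith
    show "6 * (m * p) \<le> l" "6 * (n * p\<^sup>2) \<le> k" "6 * (n * p) \<le> h"
      unfolding l_def k_def h_def of_nat_add
      by (rule order_trans[OF real_nat_ceiling_ge]; simp)+
    show "real r ^ 3 * (2 * r + real r ^ 3 * k) + 3 * r < p * c * (n - 1) / 4"
      using a1 by (simp only: a_def)
    show "2 * r * (h + r) * (real h)\<^sup>2 < (p * c * (n - 1) / 4) ^ 4"
      using a2 by (simp only: a_def)
  qed (use p c cl r in \<open>auto simp: l_def k_def h_def\<close>)
  also have "\<dots> \<le> measure_pmf.prob (random_labelling n m p)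
           {S. uniquely_determined n m p (intersection_graph n S) (assoc_bipartite n S)}"
    by (intro measure_pmf.finite_measure_mono)
       (auto intro: typical_labelling.uniquely_determined_assoc_bipartite)
  finally show ?thesis using e5 e14 e6 by linarith
qed

theorem theorem4:
  fixes \<alpha> :: real and m :: "nat \<Rightarrow> nat" and p :: "nat \<Rightarrow> real"
  assumes "0 < \<alpha>" and "\<alpha> < 1"
    and "\<And>n. \<bar>real (m n) - real n powr \<alpha>\<bar> < 1"
    and "\<And>n. 0 \<le> p n \<and> p n \<le> 1"
    and "p \<in> \<Omega>(\<lambda>n. sqrt (1 / (real n * real (m n))))"
    and "(\<lambda>n. real (m n) * (p n)\<^sup>2) \<in> O(\<lambda>_. 1)"
  shows "(\<lambda>n. measure_pmf.prob (random_labelling n (m n) (p n))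
           {S. uniquely_determined n (m n) (p n) (intersection_graph n S) (assoc_bipartite n S)})
         \<longlonglongrightarrow> 1"
proof -
  let ?P = "\<lambda>n. measure_pmf.prob (random_labelling n (m n) (p n))
           {S. uniquely_determined n (m n) (p n) (intersection_graph n S) (assoc_bipartite n S)}"
  define \<beta> where "\<beta> = min \<alpha> (1 - \<alpha>) / 16"
  define r where "r n = nat \<lceil>real n powr \<beta>\<rceil>" for n :: nat
  have \<beta>: "0 < \<beta>" "16 * \<beta> \<le> \<alpha>" "16 * \<beta> \<le> 1 - \<alpha>" using assms(1,2) by (auto simp: \<beta>_def)
  obtain C where C: "0 < C" "\<forall>\<^sub>F n in sequentially. m n * (p n)\<^sup>2 \<le> C"
    using assms(6) by (elim landau_o.bigE) auto
  obtain c0 where c0: "0 < c0" "\<forall>\<^sub>F n in sequentially. c0 * sqrt (1 / (real n * real (m n))) \<le> p n"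
    using assms(5) assms(4) by (elim landau_omega.bigE) auto
  define c where "c = exp (- (2 * (6 * C + 2)))"
  have c: "0 < c" "c \<le> 1" using C(1) by (auto simp: c_def)
  define K where "K = sqrt (2 * C)"
  define A where "A = 6 * C + 25600 * K / c + 1280000000 / (c ^ 4 * c0)"
  have "filterlim (\<lambda>n. real n powr \<beta>) at_top sequentially"
    "filterlim (\<lambda>n. real n powr \<alpha>) at_top sequentially"
    using \<beta>(1) assms(1) by real_asymp+
  then have large: "\<forall>\<^sub>F n in sequentially. A \<le> real n powr \<beta>"
    and two: "\<forall>\<^sub>F n in sequentially. 2 \<le> real n powr \<alpha>"
    by (simp_all only: filterlim_at_top)
  have "(\<lambda>n. (real n)\<^sup>2 * exp (- (c * real n powr \<beta>))) \<longlonglongrightarrow> 0" using c(1) \<beta>(1) by real_asymp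
  then have small: "\<forall>\<^sub>F n in sequentially. (real n)\<^sup>2 * exp (- (c * real n powr \<beta>)) < 1"
    by (rule order_tendstoD) simp
  have ev: "\<forall>\<^sub>F n in sequentially.
      1 - (10 * (real n)\<^sup>2 * (1/2) powr (real n powr \<beta>) + 1 / real n) \<le> ?P n"
    using C(2) c0(2) large two small eventually_ge_at_top[of 2]
  proof eventually_elim
    case (elim n)
    have n: "1 \<le> real n" and n0: "0 < real n" using elim(6) by auto
    have p: "0 \<le> p n" "p n \<le> 1" using assms(4) by auto
    have m: "real n powr \<alpha> \<le> 2 * m n" "real (m n) \<le> 2 * real n powr \<alpha>" "m n \<le> real n powr \<alpha> + 1"
      using assms(3)[of n] elim(4) by linarith+
    have x1: "1 \<le> real n powr \<beta>" using n \<beta>(1) by (simp add: ge_one_powr_ge_zero)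
    have r: "real n powr \<beta> \<le> r n" "real (r n) \<le> 2 * real n powr \<beta>"
      unfolding r_def using x1 by linarith+
    have r7: "real (r n) ^ 7 \<le> 128 * real n powr (7 * \<beta>)"
    proof -
      have "real (r n) ^ 7 \<le> (2 * real n powr \<beta>) ^ 7" using r by (intro power_mono) auto
      also have "\<dots> = 128 * real n powr (7 * \<beta>)"
        using n0 by (simp add: power_mult_distrib powr_power mult.commute)
      finally show ?thesis .
    qed
    have p_le: "p n \<le> K * real n powr (- (\<alpha> / 2))"
    proof (rule power2_le_imp_le)
      have "real n powr \<alpha> * (p n)\<^sup>2 \<le> 2 * m n * (p n)\<^sup>2" using m by (intro mult_right_mono) auto
      also have "\<dots> \<le> 2 * C" using elim(1) by simp
      finally have "(p n)\<^sup>2 \<le> 2 * C * real n powr (- \<alpha>)"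
        using n0 by (simp add: powr_minus field_simps)
      also have "\<dots> = (K * real n powr (- (\<alpha> / 2)))\<^sup>2"
        using C(1) n0 by (simp add: K_def power_mult_distrib powr_power)
      finally show "(p n)\<^sup>2 \<le> (K * real n powr (- (\<alpha> / 2)))\<^sup>2" .
    qed (use C(1) in \<open>simp add: K_def\<close>)
    have np_ge: "c0 / 2 * real n powr ((1 - \<alpha>) / 2) \<le> n * p n"
    proof -
      have mpos: "0 < real (m n)" using m(1) elim(4) by linarith
      have "n * real (m n) \<le> n * (2 * real n powr \<alpha>)" using m by (intro mult_left_mono) auto
      also have "\<dots> \<le> 4 * real n powr (1 + \<alpha>)" using n0 by (simp add: powr_add)
      finally have nm: "n * real (m n) \<le> 4 * real n powr (1 + \<alpha>)" .
      have "(real n powr (- ((1 + \<alpha>) / 2)) / 2)\<^sup>2 = 1 / (4 * real n powr (1 + \<alpha>))"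
      proof -
        have "(real n powr (- ((1 + \<alpha>) / 2)))\<^sup>2 = real n powr (- ((1 + \<alpha>) / 2) + - ((1 + \<alpha>) / 2))"
          by (simp only: power2_eq_square powr_add)
        also have "- ((1 + \<alpha>) / 2) + - ((1 + \<alpha>) / 2) = - (1 + \<alpha>)" by (simp add: field_simps)
        finally show ?thesis by (simp only: power_divide powr_minus) (simp add: field_simps)
      qed
      also have "\<dots> \<le> 1 / (n * real (m n))"
        using nm n0 mpos by (intro divide_left_mono mult_pos_pos) auto
      finally have "real n powr (- ((1 + \<alpha>) / 2)) / 2 \<le> sqrt (1 / (n * real (m n)))"
        by (rule real_le_rsqrt)
      then have "c0 * (real n powr (- ((1 + \<alpha>) / 2)) / 2) \<le> c0 * sqrt (1 / (n * real (m n)))"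
        using c0(1) by (intro mult_left_mono) auto
      also have "\<dots> \<le> p n" by (rule elim(2))
      finally have "n * (c0 * (real n powr (- ((1 + \<alpha>) / 2)) / 2)) \<le> n * p n"
        by (intro mult_left_mono) auto
      also have "n * (c0 * (real n powr (- ((1 + \<alpha>) / 2)) / 2)) =
          c0 / 2 * (real n powr 1 * real n powr (- ((1 + \<alpha>) / 2)))" using n0 by simp
      also have "real n powr 1 * real n powr (- ((1 + \<alpha>) / 2)) = real n powr ((1 - \<alpha>) / 2)"
        unfolding powr_add[symmetric] by (rule arg_cong[where f = "(powr) _"]) (simp add: field_simps)
      finally show ?thesis .
    qed
    have A: "6 * C \<le> real n powr \<beta>" "25600 * K / c \<le> real n powr \<beta>"
        "1280000000 / (c ^ 4 * c0) \<le> real n powr \<beta>"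
    proof -
      have "0 \<le> 25600 * K / c" "0 \<le> 1280000000 / (c ^ 4 * c0)" using C(1) c(1) c0(1) by (auto simp: K_def)
      then show "6 * C \<le> real n powr \<beta>" "25600 * K / c \<le> real n powr \<beta>"
        "1280000000 / (c ^ 4 * c0) \<le> real n powr \<beta>"
        using elim(3) C(1) unfolding A_def by linarith+
    qed
    have rp: "200 * (real (r n) ^ 7 * p n) \<le> c"
    proof -
      have "real (r n) ^ 7 * p n \<le> 128 * real n powr (7 * \<beta>) * (K * real n powr (- (\<alpha> / 2)))"
        using r7 p_le p by (intro mult_mono) auto
      also have "\<dots> = 128 * K * real n powr (7 * \<beta> - \<alpha> / 2)"
        by (simp add: powr_add[symmetric])
      also have "\<dots> \<le> 128 * K * real n powr (- \<beta>)"
        using \<beta> n C(1) by (intro mult_left_mono powr_mono) (auto simp: K_def)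
      also have "\<dots> = 128 * K / real n powr \<beta>" by (simp add: powr_minus_divide)
      finally have "200 * (real (r n) ^ 7 * p n) \<le> 200 * (128 * K / real n powr \<beta>)" by simp
      also have "\<dots> = 25600 * K / real n powr \<beta>" by simp
      also have "\<dots> \<le> c" using A(2) c(1) n0 by (simp add: field_simps)
      finally show ?thesis .
    qed
    have rn: "5000000 * real (r n) ^ 7 \<le> c ^ 4 * (n * p n)"
    proof -
      have "5000000 * real (r n) ^ 7 \<le> 640000000 * real n powr (7 * \<beta>)" using r7 by simp
      also have "\<dots> \<le> c ^ 4 * c0 / 2 * real n powr \<beta> * real n powr (7 * \<beta>)"
        using A(3) c(1) c0(1) by (intro mult_right_mono) (auto simp: field_simps)
      also have "\<dots> = c ^ 4 * (c0 / 2 * real n powr (8 * \<beta>))" by (simp add: powr_add[symmetric])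
      also have "\<dots> \<le> c ^ 4 * (c0 / 2 * real n powr ((1 - \<alpha>) / 2))"
        using \<beta> n c(1) c0(1) by (intro mult_left_mono powr_mono) auto
      also have "\<dots> \<le> c ^ 4 * (n * p n)" using np_ge c(1) by (intro mult_left_mono) auto
      finally show ?thesis .
    qed
    have "1 - (10 * (real n)\<^sup>2 * (1/2) ^ r n + 1 / real n) \<le> ?P n"
    proof (rule prob_uniquely_determined_ge[where C = C, folded c_def])
      have "real n powr \<alpha> \<le> real n powr 1" using n assms(2) by (intro powr_mono) auto
      then have "real (m n) \<le> real (2 * n)" using m(3) n by simp
      then show "m n \<le> 2 * n" by (simp only: of_nat_le_iff)
      have r1: "1 \<le> real (r n)" using r(1) x1 by linarith
      then show "1 \<le> r n" by simp
      have "1 * p n \<le> real (r n) ^ 7 * p n" using r1 p by (intro mult_right_mono one_le_power) auto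
      then show "p n \<le> 1/2" using rp c(2) by linarith
      show "6 * C \<le> r n" using A(1) r(1) by linarith
      have "exp (- (c * r n)) \<le> exp (- (c * real n powr \<beta>))" using r(1) c(1) by simp
      then have "(real n)\<^sup>2 * exp (- (c * r n)) \<le> (real n)\<^sup>2 * exp (- (c * real n powr \<beta>))"
        by (intro mult_left_mono) auto
      then show "(real n)\<^sup>2 * exp (- (c * r n)) \<le> 1" using elim(5) by linarith
    qed (use elim p C(1) rp rn in auto)
    moreover have "(1/2) ^ r n \<le> (1/2 :: real) powr (real n powr \<beta>)"
    proof -
      have "(1/2 :: real) ^ r n = (1/2) powr r n" by (simp add: powr_realpow)
      also have "\<dots> \<le> (1/2) powr (real n powr \<beta>)" using r(1) by (intro powr_mono') auto
      finally show ?thesis .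
    qed
    then have "10 * (real n)\<^sup>2 * (1/2) ^ r n \<le> 10 * (real n)\<^sup>2 * (1/2) powr (real n powr \<beta>)"
      by (intro mult_left_mono) auto
    ultimately show ?case by linarith
  qed
  have lim: "(\<lambda>n. 1 - (10 * (real n)\<^sup>2 * (1/2) powr (real n powr \<beta>) + 1 / real n)) \<longlonglongrightarrow> 1"
    using \<beta>(1) by real_asymp
  show ?thesis
    by (rule tendsto_sandwich[OF ev _ lim tendsto_const]) simp
qed

end
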